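(* Let $0<\alpha\leq 1$ and let $-A$ be the generator of an $\alpha$-Kreiss bounded $C_0$-semigroup $(T_t)_{t\geq 0}$ on a complex Hilbert space $H$. Then $$\|T_t\| = \mathcal{O}\left(\frac{t^{\alpha}}{\sqrt{\log(t)}}\right)\quad\text{as } t\to\infty.$$
   Context: For a closed operator $A$, $\sigma(A)$ is its spectrum and $R(\lambda,A)=(\lambda-A)^{-1}$ its resolvent. Let $-A$ be the generator of a $C_0$-semigroup $(T_t)_{t\ge 0}$ on a complex Banach space. For $\alpha>0$, the semigroup $(T_t)_{t\ge 0}$ is called $\alpha$-Kreiss bounded if $\sigma(A)\subset\{\lambda\in\mathbb{C}:\operatorname{Re}(\lambda)\ge 0\}$ and there is a constant $C>0$ such that $\|R(\lambda,A)\|\le \dfrac{C}{(-\operatorname{Re}(\lambda))^{\alpha}}$ for all $\lambda\in\mathbb{C}$ with $\operatorname{Re}(\lambda)<0$. *)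

theory Defs
  imports "HOL-Analysis.Analysis" "HOL-Library.Landau_Symbols"
begin

class complex_banach = banach +
  fixes scaleC :: "complex \<Rightarrow> 'a \<Rightarrow> 'a" (infixr "*\<^sub>C" 75)
  assumes scaleC_add_right: "c *\<^sub>C (x + y) = c *\<^sub>C x + c *\<^sub>C y"
    and scaleC_add_left: "(c + d) *\<^sub>C x = c *\<^sub>C x + d *\<^sub>C x"
    and scaleC_scaleC: "c *\<^sub>C d *\<^sub>C x = (c * d) *\<^sub>C x"
    and scaleC_of_real: "complex_of_real r *\<^sub>C x = r *\<^sub>R x"
    and norm_scaleC: "norm (c *\<^sub>C x) = cmod c * norm x"

text \<open>
  The last axiom contains positive definiteness of the inner product and says that it induces
  the (complete) norm.
\<close>

class complex_hilbert_space = complex_banach +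
  fixes cinner :: "'a \<Rightarrow> 'a \<Rightarrow> complex"
  assumes cinner_commute: "cinner x y = cnj (cinner y x)"
    and cinner_add_left: "cinner (x + y) z = cinner x z + cinner y z"
    and cinner_scaleC_left: "cinner (c *\<^sub>C x) y = c * cinner x y"
    and cinner_self: "cinner x x = complex_of_real ((norm x)\<^sup>2)"

instantiation complex :: complex_hilbert_space
begin

definition scaleC_complex :: "complex \<Rightarrow> complex \<Rightarrow> complex" where
  "scaleC_complex c x = c * x"

definition cinner_complex :: "complex \<Rightarrow> complex \<Rightarrow> complex" where
  "cinner_complex x y = x * cnj y"

instance
  by standard
    (simp_all add: scaleC_complex_def cinner_complex_def algebra_simps scaleR_conv_of_real
      norm_mult complex_norm_square [symmetric] flip: of_real_power)

end

definition bounded_clinear :: "('a::complex_banach \<Rightarrow> 'a) \<Rightarrow> bool" where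
  "bounded_clinear f \<longleftrightarrow> bounded_linear f \<and> (\<forall>c x. f (c *\<^sub>C x) = c *\<^sub>C f x)"

text \<open>
  An unbounded operator is given by its domain \<open>D\<close> and a function \<open>A\<close>, of which only the values
  on \<open>D\<close> matter.
\<close>

definition resolvent :: "'a::complex_banach set \<Rightarrow> ('a \<Rightarrow> 'a) \<Rightarrow> complex \<Rightarrow> 'a \<Rightarrow> 'a" where
  "resolvent D A l = inv_into D (\<lambda>x. l *\<^sub>C x - A x)"

definition spectrum :: "'a::complex_banach set \<Rightarrow> ('a \<Rightarrow> 'a) \<Rightarrow> complex set" where
  "spectrum D A =
     {l. \<not> (bij_betw (\<lambda>x. l *\<^sub>C x - A x) D UNIV \<and> bounded_clinear (resolvent D A l))}"

definition C0_semigroup :: "(real \<Rightarrow> 'a::complex_banach \<Rightarrow> 'a) \<Rightarrow> bool" where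
  "C0_semigroup T \<longleftrightarrow>
     (\<forall>t\<ge>0. bounded_clinear (T t)) \<and>
     T 0 = id \<and>
     (\<forall>s\<ge>0. \<forall>t\<ge>0. T (s + t) = T s \<circ> T t) \<and>
     (\<forall>x. ((\<lambda>t. T t x) \<longlongrightarrow> x) (at_right 0))"

definition is_generator ::
    "(real \<Rightarrow> 'a::complex_banach \<Rightarrow> 'a) \<Rightarrow> 'a set \<Rightarrow> ('a \<Rightarrow> 'a) \<Rightarrow> bool" where
  "is_generator T D G \<longleftrightarrow>
     D = {x. \<exists>y. ((\<lambda>h. (T h x - x) /\<^sub>R h) \<longlongrightarrow> y) (at_right 0)} \<and>
     (\<forall>x\<in>D. ((\<lambda>h. (T h x - x) /\<^sub>R h) \<longlongrightarrow> G x) (at_right 0))"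

text \<open>
  The generator is \<open>-A\<close>. The domain \<open>D\<close> and the values of \<open>A\<close> on \<open>D\<close> are determined by \<open>T\<close>,
  so the existential quantifier over them involves no choice.
\<close>

definition Kreiss_bounded :: "real \<Rightarrow> (real \<Rightarrow> 'a::complex_banach \<Rightarrow> 'a) \<Rightarrow> bool" where
  "Kreiss_bounded \<alpha> T \<longleftrightarrow>
     (\<exists>D A. is_generator T D (\<lambda>x. - A x) \<and>
        spectrum D A \<subseteq> {l. Re l \<ge> 0} \<and>
        (\<exists>C>0. \<forall>l. Re l < 0 \<longrightarrow> onorm (resolvent D A l) \<le> C / (- Re l) powr \<alpha>))"

end

theory Submission
  imports Defs
begin

text \<open>
  For a smooth compactly supported \<open>\<Phi>\<close> on \<open>(0, \<infinity>)\<close> the function \<open>u s = \<Phi> s e\<^sup>-\<^sup>e\<^sup>s T s x\<close> satisfies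
  \<open>u' + (A + e) u = \<Phi>' s e\<^sup>-\<^sup>e\<^sup>s T s x\<close>, so Plancherel's theorem and the resolvent bound on the line
  \<open>Re l = - e\<close> give
  \<open>\<integral> \<Phi>\<^sup>2 \<parallel>e\<^sup>-\<^sup>e\<^sup>s T s x\<parallel>\<^sup>2 \<le> (C e\<^sup>-\<^sup>\<alpha>)\<^sup>2 \<integral> \<Phi>'\<^sup>2 \<parallel>e\<^sup>-\<^sup>e\<^sup>s T s x\<parallel>\<^sup>2\<close>.
  A bootstrap in \<open>e\<close> shows that every exponential growth rate \<open>e > 0\<close> is admissible, after which \<open>\<Phi>\<close> may
  be a step that never returns to \<open>0\<close>. The choice \<open>e = 1 / t\<close> yields
  \<open>\<integral>\<^sub>2\<^sup>t \<parallel>T s x\<parallel>\<^sup>2 = O(t\<^sup>2\<^sup>\<alpha>) \<parallel>x\<parallel>\<^sup>2\<close>. The choice \<open>e = 1 / L\<close>, with a step rising on \<open>[t - 2 L, t - L]\<close>,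
  bounds \<open>\<parallel>T t x\<parallel>\<^sup>2\<close> by a constant times the integral of \<open>\<parallel>T s x\<parallel>\<^sup>2\<close> over that window. Adding up the
  \<open>log t\<close> many disjoint windows with \<open>L = 2\<^sup>k\<close> gives \<open>log t \<parallel>T t x\<parallel>\<^sup>2 = O(t\<^sup>2\<^sup>\<alpha>) \<parallel>x\<parallel>\<^sup>2\<close>.
\<close>

subsection \<open>Complex Hilbert spaces\<close>

lemma scaleR_scaleC: "(r *\<^sub>R c) *\<^sub>C x = r *\<^sub>R (c *\<^sub>C (x::'a::complex_banach))"
  by (metis scaleC_of_real scaleC_scaleC scaleR_conv_of_real)

lemma scaleC_scaleR: "c *\<^sub>C (r *\<^sub>R x) = r *\<^sub>R (c *\<^sub>C (x::'a::complex_banach))"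
  by (metis mult.commute scaleC_of_real scaleC_scaleC)

lemma bounded_bilinear_scaleC: "bounded_bilinear ((*\<^sub>C) :: complex \<Rightarrow> 'a::complex_banach \<Rightarrow> 'a)"
proof
  show "\<exists>K. \<forall>a b. norm (a *\<^sub>C (b::'a)) \<le> norm a * norm b * K"
    by (rule exI[of _ 1]) (simp add: norm_scaleC)
qed (simp_all add: scaleC_add_left scaleC_add_right scaleR_scaleC scaleC_scaleR)

interpretation scaleC: bounded_bilinear "(*\<^sub>C) :: complex \<Rightarrow> 'a::complex_banach \<Rightarrow> 'a"
  by (rule bounded_bilinear_scaleC)

text \<open>A real inner product inducing the same norm. Expansion of squares and Bessel's
  inequality need only this real part.\<close>

definition rinner :: "'a::complex_hilbert_space \<Rightarrow> 'a \<Rightarrow> real" where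
  "rinner x y = Re (cinner x y)"

lemma rinner_commute: "rinner x y = rinner y x"
  unfolding rinner_def by (subst cinner_commute) simp

lemma rinner_self: "rinner x x = (norm x)\<^sup>2"
  unfolding rinner_def by (simp add: cinner_self flip: of_real_power)

lemma rinner_add_left: "rinner (x + y) z = rinner x z + rinner y z"
  unfolding rinner_def by (simp add: cinner_add_left)

lemma rinner_scaleR_left: "rinner (r *\<^sub>R x) z = r * rinner x z"
  unfolding rinner_def by (simp add: cinner_scaleC_left flip: scaleC_of_real)

lemma rinner_add_right: "rinner z (x + y) = rinner z x + rinner z y"
  by (metis rinner_add_left rinner_commute)

lemma rinner_scaleR_right: "rinner z (r *\<^sub>R x) = r * rinner z x"
  by (metis rinner_scaleR_left rinner_commute)

lemma norm_add_squared: "(norm (x + y))\<^sup>2 = (norm x)\<^sup>2 + 2 * rinner x y + (norm y)\<^sup>2"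
  for x y :: "'a::complex_hilbert_space"
  unfolding rinner_self[symmetric]
  by (simp add: rinner_add_left rinner_add_right rinner_commute[of y x])

text \<open>The triangle inequality is already available for the norm, so one half of Cauchy-Schwarz
  follows by squaring it and cancelling.\<close>

lemma rinner_le: "rinner x y \<le> norm x * norm y"
proof -
  have "(norm (x + y))\<^sup>2 \<le> (norm x + norm y)\<^sup>2"
    by (intro power_mono norm_triangle_ineq) auto
  then show ?thesis
    by (simp add: norm_add_squared power2_sum)
qed

lemma bounded_bilinear_rinner: "bounded_bilinear (rinner :: 'a::complex_hilbert_space \<Rightarrow> _)"
proof
  have "rinner (- x) y = - rinner x y" for x y :: 'a
    using rinner_scaleR_left[of "-1" x y] by simp
  then have "\<bar>rinner x y\<bar> \<le> norm x * norm y" for x y :: 'a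
    using rinner_le[of x y] rinner_le[of "-x" y] by simp
  then show "\<exists>K. \<forall>a b. norm (rinner a (b::'a)) \<le> norm a * norm b * K"
    by (intro exI[of _ 1]) simp
qed (simp_all add: rinner_add_left rinner_add_right rinner_scaleR_left rinner_scaleR_right)

interpretation rinner: bounded_bilinear "rinner :: 'a::complex_hilbert_space \<Rightarrow> _"
  by (rule bounded_bilinear_rinner)

lemma cinner_scaleC_right: "cinner x (c *\<^sub>C y) = cnj c * cinner x y"
  by (metis cinner_commute cinner_scaleC_left complex_cnj_mult)

lemma rinner_scaleC_right: "rinner x (c *\<^sub>C y) = rinner (cnj c *\<^sub>C x) y"
  unfolding rinner_def by (simp add: cinner_scaleC_right cinner_scaleC_left)

subsection \<open>Strongly continuous semigroups\<close>

text \<open>The closed sets \<open>F n\<close> cover the space, so by Baire one of them contains a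
  ball. Differences of points of that ball bound every \<open>f i\<close> on a sphere around 0,
  hence everywhere by scaling.\<close>

theorem uniform_boundedness:
  fixes f :: "'i \<Rightarrow> 'a::banach \<Rightarrow> 'b::real_normed_vector"
  assumes lin: "\<And>i. i \<in> I \<Longrightarrow> bounded_linear (f i)"
    and bdd: "\<And>x. \<exists>B. \<forall>i\<in>I. norm (f i x) \<le> B"
  shows "\<exists>B. \<forall>i\<in>I. \<forall>x. norm (f i x) \<le> B * norm x"
proof -
  define F where "F n = (\<Inter>i\<in>I. {x. norm (f i x) \<le> real n})" for n :: nat
  have closed_F: "closed (F n)" for n
    unfolding F_def using lin
    by (intro closed_INT ballI closed_Collect_le continuous_intros)
      (auto intro: linear_continuous_on)
  have "\<exists>n. x \<in> F n" for x
  proof -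
    obtain B where B: "\<forall>i\<in>I. norm (f i x) \<le> B"
      using bdd by blast
    obtain n where n: "B \<le> real n"
      using real_arch_simple by blast
    have "norm (f i x) \<le> real n" if "i \<in> I" for i
      using bspec[OF B that] n by linarith
    then have "x \<in> F n"
      by (simp add: F_def)
    then show ?thesis ..
  qed
  then have Un: "\<Union> (range F) = UNIV"
    by auto
  have "\<exists>n. interior (F n) \<noteq> {}"
  proof (rule ccontr)
    assume "\<not> ?thesis"
    then have empty: "Met_TC.mtopology interior_of F n = {}" for n
      by (metis interior_of_eq_empty interior_open interior_subset interior_maximal mtopology_is_euclidean open_openin subset_empty)
    have mc: "Met_TC.mcomplete TYPE('a)"
      by (simp add: complete_UNIV)
    have "Met_TC.mtopology interior_of \<Union> (range F) = {}"
      by (rule Met_TC.metric_Baire_category_alt[OF mc]) (use empty closed_F in auto)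
    then show False
      by (simp add: Un)
  qed
  then obtain n x0 where "x0 \<in> interior (F n)"
    by blast
  then obtain r where r: "r > 0" "cball x0 r \<subseteq> F n"
    by (meson mem_interior_cball)
  have "norm (f i x) \<le> (2 * real n / r) * norm x" if i: "i \<in> I" for i x
  proof (cases "x = 0")
    case True
    then show ?thesis
      using lin[OF i] by (simp add: linear_0 bounded_linear.linear)
  next
    case False
    interpret bounded_linear "f i" by (rule lin[OF i])
    \<comment> \<open>Rescaled to length \<open>r\<close>, so that \<open>x0\<close> and
      \<open>x0 + y\<close> both lie in the ball inside \<open>F n\<close> and \<open>f i y\<close>
      is a difference of two bounded values.\<close>
    define y where "y = (r / norm x) *\<^sub>R x"
    have "norm y = r"
      using r False by (simp add: y_def)
    then have "x0 \<in> F n" "x0 + y \<in> F n"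
      using r by (auto simp: dist_norm)
    then have "norm (f i x0) \<le> n" "norm (f i (x0 + y)) \<le> n"
      using i by (auto simp: F_def)
    moreover have "norm (f i y) \<le> norm (f i (x0 + y)) + norm (f i x0)"
      by (metis add add_diff_cancel_left' norm_triangle_ineq4)
    ultimately have "norm (f i y) \<le> 2 * real n"
      by simp
    moreover have "norm (f i y) = (r / norm x) * norm (f i x)"
      unfolding y_def using r by (simp add: scaleR)
    ultimately show ?thesis
      using r False by (simp add: field_simps)
  qed
  then show ?thesis
    by (intro exI[of _ "2 * real n / r"]) blast
qed

section \<open>Exponential bounds and continuity of orbits\<close>

locale strongly_continuous_semigroup =
  fixes T :: "real \<Rightarrow> 'a::complex_banach \<Rightarrow> 'a"
  assumes C0: "C0_semigroup T"
begin

lemma bounded_linear_T: "t \<ge> 0 \<Longrightarrow> bounded_linear (T t)"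
  using C0 by (simp add: C0_semigroup_def bounded_clinear_def)

lemma T_scaleC: "t \<ge> 0 \<Longrightarrow> T t (c *\<^sub>C x) = c *\<^sub>C T t x"
  using C0 by (simp add: C0_semigroup_def bounded_clinear_def)

lemma T_diff: "t \<ge> 0 \<Longrightarrow> T t (x - y) = T t x - T t y"
  using bounded_linear_T by (simp add: bounded_linear.linear linear_diff)

lemma T_0 [simp]: "T 0 x = x"
  using C0 by (simp add: C0_semigroup_def)

lemma T_add: "s \<ge> 0 \<Longrightarrow> t \<ge> 0 \<Longrightarrow> T (s + t) x = T s (T t x)"
  using C0 by (simp add: C0_semigroup_def)

lemma T_tendsto_0: "((\<lambda>t. T t x) \<longlongrightarrow> x) (at_right 0)"
  using C0 by (simp add: C0_semigroup_def)

text \<open>Otherwise there are times \<open>t n\<close> tending to 0 with unbounded operator norms.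
  Each sequence \<open>T (t n) y\<close> converges to \<open>y\<close> and is thus bounded, which
  contradicts uniform boundedness.\<close>

lemma local_bound: "\<exists>d>0. \<exists>K. \<forall>t\<in>{0..d}. \<forall>x. norm (T t x) \<le> K * norm x"
proof (rule ccontr)
  assume "\<not> ?thesis"
  then have "\<exists>t x. t \<in> {0..1 / real (Suc n)} \<and> norm (T t x) > real (Suc n) * norm x" for n
    by (meson divide_pos_pos not_le of_nat_0_less_iff zero_less_Suc zero_less_one)
  then obtain t x where t: "\<And>n. t n \<in> {0..1 / real (Suc n)}"
    and x: "\<And>n. norm (T (t n) (x n)) > real (Suc n) * norm (x n)"
    by metis
  \<comment> \<open>The limit in \<open>T_tendsto_0\<close> excludes time 0. That time cannot occur,
    since \<open>T 0\<close> is the identity and has no norm growth.\<close>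
  have pos: "t n > 0" for n
  proof (rule ccontr)
    assume "\<not> ?thesis"
    then have "t n = 0"
      using t[of n] by auto
    moreover have "1 * norm (x n) \<le> real (Suc n) * norm (x n)"
      by (intro mult_right_mono) auto
    ultimately show False
      using x[of n] by simp
  qed
  have "t \<longlonglongrightarrow> 0"
  proof (rule tendsto_sandwich[where f = "\<lambda>_. 0" and h = "\<lambda>n. 1 / real (Suc n)"])
    show "(\<lambda>n. 1 / real (Suc n)) \<longlonglongrightarrow> 0"
      by (rule LIMSEQ_Suc) (rule lim_1_over_n)
  qed (use t in auto)
  then have lim: "filterlim t (at_right 0) sequentially"
    using pos by (simp add: filterlim_at less_imp_neq[OF pos, symmetric])
  have bdd: "\<exists>B. \<forall>n\<in>UNIV. norm (T (t n) y) \<le> B" for y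
  proof -
    have "(\<lambda>n. T (t n) y) \<longlonglongrightarrow> y"
      using filterlim_compose[OF T_tendsto_0 lim] .
    then have "Bseq (\<lambda>n. T (t n) y)"
      by (intro convergent_imp_Bseq) (auto simp: convergent_def)
    then show ?thesis
      by (auto simp: Bseq_def)
  qed
  have "\<exists>B. \<forall>n\<in>UNIV. \<forall>y. norm (T (t n) y) \<le> B * norm y"
    by (rule uniform_boundedness[OF _ bdd]) (use pos bounded_linear_T less_imp_le in blast)
  then obtain B where B: "\<And>n y. norm (T (t n) y) \<le> B * norm y"
    by auto
  obtain n where "B \<le> real n"
    using real_arch_simple by blast
  then have "B * norm (x n) \<le> real (Suc n) * norm (x n)"
    by (intro mult_right_mono) auto
  then show False
    using B[of n "x n"] x[of n] by linarith
qed

lemma exponential_growth: "\<exists>K w. K \<ge> 1 \<and> w \<ge> 0 \<and> (\<forall>t\<ge>0. \<forall>x. norm (T t x) \<le> K * exp (w * t) * norm x)"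
proof -
  obtain d K0 where d: "d > 0" and K0: "\<And>t x. t \<in> {0..d} \<Longrightarrow> norm (T t x) \<le> K0 * norm x"
    using local_bound by blast
  define K where "K = max 1 K0"
  have K1: "K \<ge> 1"
    by (simp add: K_def)
  have K: "norm (T t x) \<le> K * norm x" if "t \<in> {0..d}" for t x
    using K0[OF that, of x] mult_right_mono[of K0 K "norm x"] by (simp add: K_def)
  have iter: "norm (T t x) \<le> K ^ n * norm x" if "0 \<le> t" "t \<le> real n * d" for n t x
    using that
  proof (induction n arbitrary: t)
    case 0
    then show ?case by simp
  next
    case (Suc n)
    show ?case
    proof (cases "t \<le> d")
      case True
      have "K * norm x \<le> K * (K ^ n * norm x)"
        using K1 mult_right_mono[OF one_le_power[OF K1, of n], of "norm x"]
        by (intro mult_left_mono) auto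
      then show ?thesis
        using K[of t x] True Suc.prems by simp
    next
      case False
      have "T t x = T d (T (t - d) x)"
        using T_add[of d "t - d" x] False d by simp
      also have "norm \<dots> \<le> K * norm (T (t - d) x)"
        using d by (intro K) auto
      also have "\<dots> \<le> K * (K ^ n * norm x)"
        using False K1 Suc.prems by (intro mult_left_mono Suc.IH) (auto simp: algebra_simps)
      finally show ?thesis by simp
    qed
  qed
  have "norm (T t x) \<le> K * exp ((ln K / d) * t) * norm x" if t: "t \<ge> 0" for t x
  proof -
    define n where "n = nat \<lceil>t / d\<rceil>"
    have n: "t / d \<le> real n" "real n \<le> t / d + 1"
      unfolding n_def using t d by (auto simp: of_nat_ceiling)
    have "norm (T t x) \<le> K ^ n * norm x"
      using n d t by (intro iter) (auto simp: field_simps)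
    also have "K ^ n = exp (real n * ln K)"
      using K1 by (simp add: exp_of_nat_mult)
    also have "\<dots> \<le> exp ((t / d + 1) * ln K)"
      using n K1 by (intro iffD2[OF exp_le_cancel_iff] mult_right_mono) auto
    also have "\<dots> = K * exp ((ln K / d) * t)"
      using K1 by (simp add: ring_distribs exp_add mult.commute)
    finally show ?thesis
      by (simp add: mult_right_mono)
  qed
  then show ?thesis
    using K1 d by (intro exI[of _ K] exI[of _ "ln K / d"]) auto
qed

lemma bound_on_interval: "\<exists>K\<ge>1. \<forall>t\<in>{0..r}. \<forall>x. norm (T t x) \<le> K * norm x"
proof -
  obtain K w where K: "K \<ge> 1" "w \<ge> 0" "\<And>t x. t \<ge> 0 \<Longrightarrow> norm (T t x) \<le> K * exp (w * t) * norm x"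
    using exponential_growth by blast
  have "norm (T t x) \<le> (K * exp (w * \<bar>r\<bar>)) * norm x" if "t \<in> {0..r}" for t x
  proof -
    have "K * exp (w * t) * norm x \<le> K * exp (w * \<bar>r\<bar>) * norm x"
      using that K by (intro mult_right_mono mult_left_mono) (auto intro!: mult_left_mono)
    then show ?thesis
      using K(3)[of t x] that by auto
  qed
  moreover have "1 * 1 \<le> K * exp (w * \<bar>r\<bar>)"
    using K by (intro mult_mono) auto
  ultimately show ?thesis by auto
qed

text \<open>Both sides of \<open>s\<close> are handled by
  \<open>T (r + h) x - T r x = T r (T h x - x)\<close>. From the left the base point
  \<open>r\<close> varies, hence the bound on all of \<open>{0..s+1}\<close>.\<close>

lemma continuous_on_T: "continuous_on {0..} (\<lambda>t. T t x)"
  unfolding continuous_on_iff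
proof (intro ballI allI impI)
  fix s e :: real
  assume s: "s \<in> {0..}" and e: "e > 0"
  obtain K where K: "K \<ge> 1" "\<And>t x. t \<in> {0..s+1} \<Longrightarrow> norm (T t x) \<le> K * norm x"
    using bound_on_interval by blast
  have "eventually (\<lambda>h. dist (T h x) x < e / K) (at_right 0)"
    using T_tendsto_0[of x] K(1) e by (intro tendstoD) auto
  then obtain d where d: "d > 0" "\<And>h. 0 < h \<Longrightarrow> h < d \<Longrightarrow> norm (T h x - x) < e / K"
    by (auto simp: eventually_at_right_field dist_norm)
  have main: "norm (T (r + h) x - T r x) < e" if "0 \<le> r" "r \<le> s + 1" "0 \<le> h" "h < d" for r h
  proof -
    have "norm (T (r + h) x - T r x) = norm (T r (T h x - x))"
      using that by (simp add: T_add T_diff)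
    also have "\<dots> \<le> K * norm (T h x - x)"
      using that by (intro K) auto
    also have "\<dots> < K * (e / K)"
      using d(2)[of h] that K e by (intro mult_strict_left_mono) (cases "h = 0"; auto)+
    finally show ?thesis
      using K by simp
  qed
  have "dist (T t x) (T s x) < e" if "t \<in> {0..}" "dist t s < min d 1" for t
  proof (cases "t \<le> s")
    case True
    then show ?thesis
      using main[of t "s - t"] that s by (auto simp: dist_norm norm_minus_commute)
  next
    case False
    then show ?thesis
      using main[of s "t - s"] that s by (auto simp: dist_norm)
  qed
  then show "\<exists>d>0. \<forall>t\<in>{0..}. dist t s < d \<longrightarrow> dist (T t x) (T s x) < e"
    using d(1) by (intro exI[of _ "min d 1"]) auto
qed

lemma continuous_on_T_comp [continuous_intros]:
  assumes "continuous_on S f" "\<And>s. s \<in> S \<Longrightarrow> f s \<ge> 0"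
  shows "continuous_on S (\<lambda>s. T (f s) x)"
  using continuous_on_compose2[OF continuous_on_T assms(1)] assms(2) by force

end

subsection \<open>Fourier coefficients of vector-valued functions\<close>

text \<open>Not divided by the period; this accounts for the factors \<open>P\<close> below.\<close>

definition fourier_coeff :: "real \<Rightarrow> (real \<Rightarrow> 'a::complex_banach) \<Rightarrow> int \<Rightarrow> 'a" where
  "fourier_coeff P u k = integral {0..P} (\<lambda>s. cis (- (2 * pi * of_int k * s / P)) *\<^sub>C u s)"

lemma has_integral_cis_period:
  assumes P: "P > 0"
  shows "((\<lambda>s. cis (2 * pi * of_int k * s / P)) has_integral (if k = 0 then of_real P else 0)) {0..P}"
proof (cases "k = 0")
  case True
  then show ?thesis
    using has_integral_const_real[of "1::complex" 0 P] P by (simp add: scaleR_conv_of_real)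
next
  case False
  define c where "c = \<i> * (2 * pi * of_int k / P)"
  have c: "c \<noteq> 0"
    using P False by (simp add: c_def)
  have eq: "cis (2 * pi * of_int k * s / P) = exp (c * of_real s)" for s
    by (simp add: c_def cis_conv_exp field_simps)
  have "((\<lambda>s. exp (c * of_real s)) has_integral exp (c * of_real P) / c - exp (c * of_real 0) / c) {0..P}"
  proof (rule fundamental_theorem_of_calculus)
    show "((\<lambda>s. exp (c * of_real s) / c) has_vector_derivative exp (c * of_real s)) (at s within {0..P})"
      for s
      by (rule has_vector_derivative_real_field) (use c in \<open>auto intro!: derivative_eq_intros\<close>)
  qed (use P in auto)
  moreover have "exp (c * of_real P) = 1"
    unfolding eq[symmetric] using P by (simp add: cis_multiple_2pi)
  ultimately show ?thesis
    using False by (simp add: eq)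
qed

lemma continuous_on_cis' [continuous_intros]:
  "continuous_on S f \<Longrightarrow> continuous_on S (\<lambda>s. cis (f s))"
  by (simp add: cis_conv_exp) (intro continuous_intros)

lemma continuous_on_scaleC [continuous_intros]:
  fixes g :: "_ \<Rightarrow> 'a::complex_banach"
  shows "continuous_on S f \<Longrightarrow> continuous_on S g \<Longrightarrow> continuous_on S (\<lambda>s. f s *\<^sub>C g s)"
  by (rule scaleC.continuous_on)

lemma continuous_on_rinner [continuous_intros]:
  "continuous_on S f \<Longrightarrow> continuous_on S g \<Longrightarrow> continuous_on S (\<lambda>s. rinner (f s) (g s))"
  by (rule rinner.continuous_on)

text \<open>The unimodular factor moves to the other argument as its conjugate. Frequencies come
  through an index map \<open>\<kappa>\<close> so that the shifted range
  \<open>int j - int N\<close> fits.\<close>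

lemma has_integral_rinner_trig_sum:
  fixes u :: "real \<Rightarrow> 'a::complex_hilbert_space"
  assumes P: "P > 0" and "finite J" and u: "continuous_on {0..P} u"
  shows "((\<lambda>s. rinner (u s) (\<Sum>j\<in>J. cis (2 * pi * of_int (\<kappa> j) * s / P) *\<^sub>C v j)) has_integral
            (\<Sum>j\<in>J. rinner (fourier_coeff P u (\<kappa> j)) (v j))) {0..P}"
proof -
  have "((\<lambda>s. \<Sum>j\<in>J. rinner (cis (- (2 * pi * of_int (\<kappa> j) * s / P)) *\<^sub>C u s) (v j)) has_integral
            (\<Sum>j\<in>J. rinner (fourier_coeff P u (\<kappa> j)) (v j))) {0..P}"
  proof (intro has_integral_sum assms)
    fix j
    have "(\<lambda>s. cis (- (2 * pi * of_int (\<kappa> j) * s / P)) *\<^sub>C u s) integrable_on {0..P}"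
      using P by (intro integrable_continuous_interval continuous_intros u) auto
    then have "((\<lambda>s. cis (- (2 * pi * of_int (\<kappa> j) * s / P)) *\<^sub>C u s) has_integral
                 fourier_coeff P u (\<kappa> j)) {0..P}"
      unfolding fourier_coeff_def by (rule integrable_integral)
    from has_integral_linear[OF this rinner.bounded_linear_left[of "v j"]]
    show "((\<lambda>s. rinner (cis (- (2 * pi * of_int (\<kappa> j) * s / P)) *\<^sub>C u s) (v j)) has_integral
            rinner (fourier_coeff P u (\<kappa> j)) (v j)) {0..P}"
      by (simp add: o_def)
  qed
  then show ?thesis
    by (simp add: rinner.sum_right rinner_scaleC_right cis_cnj)
qed

lemma fourier_coeff_trig_sum:
  fixes v :: "'j \<Rightarrow> 'a::complex_banach"
  assumes P: "P > 0" and J: "finite J" "inj_on \<kappa> J" "i \<in> J"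
  shows "fourier_coeff P (\<lambda>s. \<Sum>j\<in>J. cis (2 * pi * of_int (\<kappa> j) * s / P) *\<^sub>C v j) (\<kappa> i) = P *\<^sub>R v i"
proof -
  have "((\<lambda>s. \<Sum>j\<in>J. cis (2 * pi * of_int (\<kappa> j - \<kappa> i) * s / P) *\<^sub>C v j) has_integral
          (\<Sum>j\<in>J. (if \<kappa> j - \<kappa> i = 0 then of_real P else 0) *\<^sub>C v j)) {0..P}"
  proof (intro has_integral_sum J)
    fix j
    show "((\<lambda>s. cis (2 * pi * of_int (\<kappa> j - \<kappa> i) * s / P) *\<^sub>C v j) has_integral
          (if \<kappa> j - \<kappa> i = 0 then of_real P else 0) *\<^sub>C v j) {0..P}"
      using has_integral_linear[OF has_integral_cis_period[OF P, of "\<kappa> j - \<kappa> i"]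
          scaleC.bounded_linear_left[of "v j"]]
      by (simp only: o_def)
  qed
  moreover have "(\<Sum>j\<in>J. (if \<kappa> j - \<kappa> i = 0 then of_real P else 0) *\<^sub>C v j) =
      (\<Sum>j\<in>J. if j = i then P *\<^sub>R v j else 0)"
    using J by (intro sum.cong) (auto simp: scaleC_of_real scaleC.zero_left dest: inj_onD)
  moreover have "(\<Sum>j\<in>J. cis (2 * pi * of_int (\<kappa> j - \<kappa> i) * s / P) *\<^sub>C v j) =
     cis (- (2 * pi * of_int (\<kappa> i) * s / P)) *\<^sub>C (\<Sum>j\<in>J. cis (2 * pi * of_int (\<kappa> j) * s / P) *\<^sub>C v j)" for s
    unfolding scaleC.sum_right scaleC_scaleC cis_mult
    using P by (intro sum.cong refl arg_cong2[of _ _ _ _ "(*\<^sub>C)"] arg_cong[of _ _ cis]) (simp add: field_simps)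
  ultimately show ?thesis
    unfolding fourier_coeff_def using J by (simp add: integral_unique)
qed

text \<open>The integral of the squared norm of \<open>f - p\<close> is nonnegative, where
  \<open>p\<close> is the orthogonal projection of \<open>f\<close> to the chosen frequencies. Both
  \<open>f\<close> against \<open>p\<close> and \<open>p\<close> against \<open>p\<close> integrate
  to \<open>S / P\<close>.\<close>

lemma Bessel_inequality:
  fixes f :: "real \<Rightarrow> 'a::complex_hilbert_space"
  assumes P: "P > 0" and J: "finite J" "inj_on \<kappa> J" and f: "continuous_on {0..P} f"
  shows "(\<Sum>j\<in>J. (norm (fourier_coeff P f (\<kappa> j)))\<^sup>2) \<le> P * integral {0..P} (\<lambda>s. (norm (f s))\<^sup>2)"
proof -
  define v where "v j = (1 / P) *\<^sub>R fourier_coeff P f (\<kappa> j)" for j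
  define p where "p s = (\<Sum>j\<in>J. cis (2 * pi * of_int (\<kappa> j) * s / P) *\<^sub>C v j)" for s
  define S where "S = (\<Sum>j\<in>J. (norm (fourier_coeff P f (\<kappa> j)))\<^sup>2)"
  have p: "continuous_on {0..P} p"
    unfolding p_def using P by (intro continuous_intros) auto
  have fp: "((\<lambda>s. rinner (f s) (p s)) has_integral S / P) {0..P}"
    using has_integral_rinner_trig_sum[OF P J(1) f, of \<kappa> v]
    unfolding p_def[symmetric]
    by (simp add: v_def rinner.scaleR_right rinner_self S_def sum_divide_distrib)
  have "fourier_coeff P p (\<kappa> j) = fourier_coeff P f (\<kappa> j)" if "j \<in> J" for j
    using fourier_coeff_trig_sum[OF P J that, of v] P unfolding p_def[symmetric]
    by (simp add: v_def)
  then have "(\<Sum>j\<in>J. rinner (fourier_coeff P p (\<kappa> j)) (v j)) = S / P"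
    by (simp add: v_def rinner.scaleR_right rinner_self S_def sum_divide_distrib)
  with has_integral_rinner_trig_sum[OF P J(1) p, of \<kappa> v]
  have pp: "((\<lambda>s. rinner (p s) (p s)) has_integral S / P) {0..P}"
    unfolding p_def[symmetric] by simp
  have ff: "((\<lambda>s. rinner (f s) (f s)) has_integral integral {0..P} (\<lambda>s. (norm (f s))\<^sup>2)) {0..P}"
    unfolding rinner_self
    by (intro integrable_integral integrable_continuous_interval continuous_intros f)
  have "((\<lambda>s. (norm (f s - p s))\<^sup>2) has_integral
         integral {0..P} (\<lambda>s. (norm (f s))\<^sup>2) - 2 * (S / P) + S / P) {0..P}"
    using has_integral_add[OF has_integral_diff[OF ff has_integral_mult_right[OF fp, of 2]] pp]
    by (rule has_integral_eq[rotated])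
      (simp flip: rinner_self add: rinner.diff_left rinner.diff_right rinner_commute[of "p _" "f _"])
  then have "0 \<le> integral {0..P} (\<lambda>s. (norm (f s))\<^sup>2) - 2 * (S / P) + S / P"
    by (rule has_integral_nonneg) simp
  then show ?thesis
    using P unfolding S_def[symmetric] by (simp add: field_simps)
qed

section \<open>A nonnegative trigonometric kernel\<close>

text \<open>Binomial expansion of \<open>cis (\<theta> / 2) + cis (- (\<theta> / 2))\<close>; the
  even exponent makes all resulting frequencies integers.\<close>

lemma cos_power_trig_sum:
  "(\<Sum>j\<le>2 * N. of_real (real ((2 * N) choose j)) * cis (of_int (int j - int N) * \<theta>)) =
     complex_of_real (4 ^ N * cos (\<theta> / 2) ^ (2 * N))"
proof -
  have "complex_of_real (4 ^ N * cos (\<theta> / 2) ^ (2 * N)) = (of_real (2 * cos (\<theta> / 2))) ^ (2 * N)"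
    by (simp add: power_mult_distrib power_mult)
  also have "complex_of_real (2 * cos (\<theta> / 2)) = cis (\<theta> / 2) + cis (- (\<theta> / 2))"
    by (simp add: complex_eq_iff)
  also have "\<dots> ^ (2 * N) = (\<Sum>j\<le>2 * N. of_nat ((2 * N) choose j) * cis (\<theta> / 2) ^ j * cis (- (\<theta> / 2)) ^ (2 * N - j))"
    by (rule binomial_ring)
  also have "\<dots> = (\<Sum>j\<le>2 * N. of_real (real ((2 * N) choose j)) * cis (of_int (int j - int N) * \<theta>))"
  proof (intro sum.cong refl)
    fix j assume "j \<in> {..2 * N}"
    then have "real j * (\<theta> / 2) + real (2 * N - j) * (- (\<theta> / 2)) = of_int (int j - int N) * \<theta>"
      by (simp add: of_nat_diff field_simps)
    then have "cis (\<theta> / 2) ^ j * cis (- (\<theta> / 2)) ^ (2 * N - j) = cis (of_int (int j - int N) * \<theta>)"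
      unfolding Complex.DeMoivre cis_mult by (rule arg_cong)
    then show "of_nat ((2 * N) choose j) * cis (\<theta> / 2) ^ j * cis (- (\<theta> / 2)) ^ (2 * N - j) =
        of_real (real ((2 * N) choose j)) * cis (of_int (int j - int N) * \<theta>)"
      by (simp only: mult.assoc of_real_of_nat_eq)
  qed
  finally show ?thesis by simp
qed


text \<open>
  The kernel \<open>c\<^sub>N cos (\<theta> / 2) ^ (2 * N)\<close>, normalised to mean value 1, replaces Fejer's kernel:
  it is nonnegative, concentrates at 0, and its Fourier coefficients lie in \<open>[0, 1]\<close>.
\<close>

definition cos_weight :: "nat \<Rightarrow> nat \<Rightarrow> real" where
  "cos_weight N j = real ((2 * N) choose j) / real ((2 * N) choose N)"

definition cos_kernel :: "nat \<Rightarrow> real \<Rightarrow> real" where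
  "cos_kernel N \<theta> = 4 ^ N / real ((2 * N) choose N) * cos (\<theta> / 2) ^ (2 * N)"

text \<open>The mean over one period of \<open>u\<close> against the translated
  \<open>cos_kernel N\<close>, written out as a trigonometric sum.\<close>

definition trig_approx :: "real \<Rightarrow> (real \<Rightarrow> 'a::complex_banach) \<Rightarrow> nat \<Rightarrow> real \<Rightarrow> 'a" where
  "trig_approx P u N s = (\<Sum>j\<le>2 * N. cis (2 * pi * of_int (int j - int N) * s / P) *\<^sub>C
      ((cos_weight N j / P) *\<^sub>R fourier_coeff P u (int j - int N)))"

lemma cos_weight_le_1: "cos_weight N j \<le> 1"
  using binomial_maximum'[of N j] by (simp add: cos_weight_def divide_le_eq)

lemma cos_kernel_nonneg: "cos_kernel N \<theta> \<ge> 0"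
  by (simp add: cos_kernel_def power_mult)

text \<open>The normalising constant grows at most linearly in \<open>N\<close>, by the lower bound
  for central binomial coefficients. For \<open>q < 1\<close> the geometric factor therefore
  wins.\<close>

lemma cos_kernel_le:
  assumes "N > 0" "(cos (\<theta> / 2))\<^sup>2 \<le> q"
  shows "cos_kernel N \<theta> \<le> 2 * real N * q ^ N"
proof -
  have "4 ^ N / real ((2 * N) choose N) \<le> 2 * real N"
    using central_binomial_lower_bound[OF assms(1)] assms(1) by (simp add: field_simps)
  moreover have "cos (\<theta> / 2) ^ (2 * N) \<le> q ^ N"
    unfolding power_mult using assms by (intro power_mono) auto
  ultimately show ?thesis
    unfolding cos_kernel_def by (intro mult_mono) auto
qed

lemma cos_kernel_eq:
  "complex_of_real (cos_kernel N \<theta>) =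
     (\<Sum>j\<le>2 * N. of_real (cos_weight N j) * cis (of_int (int j - int N) * \<theta>))"
proof -
  have "complex_of_real (cos_kernel N \<theta>) =
      complex_of_real (4 ^ N * cos (\<theta> / 2) ^ (2 * N)) / of_real (real ((2 * N) choose N))"
    by (simp add: cos_kernel_def)
  also have "\<dots> = (\<Sum>j\<le>2 * N. of_real (real ((2 * N) choose j)) * cis (of_int (int j - int N) * \<theta>)) /
     of_real (real ((2 * N) choose N))"
    by (simp only: cos_power_trig_sum)
  finally show ?thesis
    by (simp add: sum_divide_distrib cos_weight_def)
qed

lemma has_integral_cos_kernel_convolution:
  fixes u :: "real \<Rightarrow> 'a::complex_banach"
  assumes P: "P > 0" and u: "continuous_on {0..P} u"
  shows "((\<lambda>r. cos_kernel N (2 * pi * (s - r) / P) *\<^sub>R u r) has_integral P *\<^sub>R trig_approx P u N s) {0..P}"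
proof -
  have eq: "cos_kernel N (2 * pi * (s - r) / P) *\<^sub>R u r =
    (\<Sum>j\<le>2 * N. (of_real (cos_weight N j) * cis (2 * pi * of_int (int j - int N) * s / P)) *\<^sub>C
       cis (- (2 * pi * of_int (int j - int N) * r / P)) *\<^sub>C u r)" for r
    unfolding scaleC_of_real[symmetric] cos_kernel_eq scaleC.sum_left scaleC_scaleC mult.assoc cis_mult
    using P by (intro sum.cong refl arg_cong2[of _ _ _ _ "(*\<^sub>C)"] arg_cong2[of _ _ _ _ "(*)"]
        arg_cong[of _ _ cis]) (simp add: field_simps)
  have "((\<lambda>r. cos_kernel N (2 * pi * (s - r) / P) *\<^sub>R u r) has_integral
    (\<Sum>j\<le>2 * N. (of_real (cos_weight N j) * cis (2 * pi * of_int (int j - int N) * s / P)) *\<^sub>C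
       fourier_coeff P u (int j - int N))) {0..P}"
    unfolding eq
  proof (intro has_integral_sum finite_atMost)
    fix j
    have "(\<lambda>r. cis (- (2 * pi * of_int (int j - int N) * r / P)) *\<^sub>C u r) integrable_on {0..P}"
      using P by (intro integrable_continuous_interval continuous_intros u) auto
    then have "((\<lambda>r. cis (- (2 * pi * of_int (int j - int N) * r / P)) *\<^sub>C u r) has_integral
        fourier_coeff P u (int j - int N)) {0..P}"
      unfolding fourier_coeff_def by (rule integrable_integral)
    from has_integral_linear[OF this scaleC.bounded_linear_right]
    show "((\<lambda>r. (of_real (cos_weight N j) * cis (2 * pi * of_int (int j - int N) * s / P)) *\<^sub>C
       cis (- (2 * pi * of_int (int j - int N) * r / P)) *\<^sub>C u r) has_integral
       (of_real (cos_weight N j) * cis (2 * pi * of_int (int j - int N) * s / P)) *\<^sub>C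
       fourier_coeff P u (int j - int N)) {0..P}"
      by (simp only: o_def)
  qed
  also have "(\<Sum>j\<le>2 * N. (of_real (cos_weight N j) * cis (2 * pi * of_int (int j - int N) * s / P)) *\<^sub>C
       fourier_coeff P u (int j - int N)) = P *\<^sub>R trig_approx P u N s"
    using P
    by (simp only: trig_approx_def scaleR_sum_right scaleC_scaleR scaleR_scaleC
        scaleR_scaleR scaleC_of_real flip: scaleC_scaleC) simp
  finally show ?thesis .
qed

text \<open>Convolve with the constant 1, regarded as a function into the complex Hilbert space:
  only frequency 0 survives, and its weight \<open>cos_weight N N\<close> is 1.\<close>

lemma has_integral_cos_kernel:
  assumes P: "P > 0"
  shows "((\<lambda>r. cos_kernel N (2 * pi * (s - r) / P)) has_integral P) {0..P}"
proof -
  have cis0: "fourier_coeff P (\<lambda>_. 1 :: complex) k = (if k = 0 then of_real P else 0)" for k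
    using integral_unique[OF has_integral_cis_period[OF P, of "- k"]]
    by (simp add: fourier_coeff_def scaleC_complex_def)
  have "trig_approx P (\<lambda>_. 1 :: complex) N s = (\<Sum>j\<le>2 * N. if j = N then 1 else 0)"
    unfolding trig_approx_def cis0 using P
    by (intro sum.cong) (auto simp: scaleC_complex_def cos_weight_def scaleR_conv_of_real)
  then have "trig_approx P (\<lambda>_. 1 :: complex) N s = 1"
    by simp
  with has_integral_cos_kernel_convolution[OF P, of "\<lambda>_. 1 :: complex" N s]
  have "((\<lambda>r. complex_of_real (cos_kernel N (2 * pi * (s - r) / P))) has_integral of_real P) {0..P}"
    by (simp add: scaleR_conv_of_real)
  from has_integral_linear[OF this bounded_linear_Re] show ?thesis
    by (simp add: o_def)
qed

text \<open>Approximate identity: near \<open>s\<close> uniform continuity makes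
  \<open>u r - u s\<close> small, and away from \<open>s\<close> the kernel is small. Since
  \<open>u\<close> need not be periodic, \<open>s\<close> must stay away from both ends of the
  period.\<close>

lemma trig_approx_uniform:
  fixes u :: "real \<Rightarrow> 'a::complex_banach"
  assumes P: "P > 0" and u: "continuous_on {0..P} u" and ab: "0 < a" "a \<le> b" "b < P" and e: "e > 0"
  shows "\<exists>N. \<forall>s\<in>{a..b}. norm (trig_approx P u N s - u s) \<le> e"
proof -
  have "bounded (u ` {0..P})"
    using u by (intro compact_imp_bounded compact_continuous_image) auto
  then obtain B where B: "B > 0" "\<And>s. s \<in> {0..P} \<Longrightarrow> norm (u s) \<le> B"
    by (auto simp: bounded_pos)
  have "uniformly_continuous_on {0..P} u"
    using u by (intro compact_uniformly_continuous) auto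
  then obtain d where d: "d > 0"
    "\<And>r s. r \<in> {0..P} \<Longrightarrow> s \<in> {0..P} \<Longrightarrow> dist r s < d \<Longrightarrow> dist (u r) (u s) < e / 2"
    unfolding uniformly_continuous_on_def using e by (metis half_gt_zero)
  \<comment> \<open>Besides continuity, this ensures \<open>\<bar>s - r\<bar> \<le> P - m\<close>,
    away from the next peak of the kernel at distance \<open>P\<close>.\<close>
  define m where "m = min d (min a (P - b))"
  have m: "m > 0" "m \<le> d" "m \<le> a" "m \<le> P - b"
    using d ab by (auto simp: m_def)
  \<comment> \<open>Bounds the squared cosine in the kernel whenever
    \<open>m \<le> \<bar>s - r\<bar> \<le> P - m\<close>.\<close>
  define q where "q = (cos (pi * m / P))\<^sup>2"
  have "sin (pi * m / P) > 0"
    using m ab P by (intro sin_gt_zero) (auto simp: divide_simps)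
  then have "(sin (pi * m / P))\<^sup>2 > 0"
    by simp
  then have q: "0 \<le> q" "q < 1"
    unfolding q_def cos_squared_eq[of "pi * m / P"]
    by (auto simp: abs_square_le_1)
  have "(\<lambda>n. 4 * B * (of_nat n * q ^ n)) \<longlonglongrightarrow> 4 * B * 0"
    using q by (intro tendsto_mult_left powser_times_n_limit_0) auto
  then have "eventually (\<lambda>n. 4 * B * (of_nat n * q ^ n) < e / 2) sequentially"
    using e by (intro order_tendstoD) auto
  then have "eventually (\<lambda>n. n > 0 \<and> 4 * B * (of_nat n * q ^ n) < e / 2) sequentially"
    by (intro eventually_conj eventually_gt_at_top)
  then obtain N :: nat where N: "N > 0" "4 * B * (of_nat N * q ^ N) < e / 2"
    using eventually_happens'[OF sequentially_bot] by blast
  have "norm (trig_approx P u N s - u s) \<le> e" if s: "s \<in> {a..b}" for s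
  proof -
    define K where "K r = cos_kernel N (2 * pi * (s - r) / P)" for r
    have K: "(K has_integral P) {0..P}"
      unfolding K_def by (rule has_integral_cos_kernel[OF P])
    have "((\<lambda>r. K r *\<^sub>R u r - K r *\<^sub>R u s) has_integral P *\<^sub>R trig_approx P u N s - P *\<^sub>R u s) {0..P}"
      unfolding K_def
      by (intro has_integral_diff has_integral_cos_kernel_convolution has_integral_scaleR_left
          has_integral_cos_kernel P u)
    then have int: "((\<lambda>r. K r *\<^sub>R (u r - u s)) has_integral P *\<^sub>R (trig_approx P u N s - u s)) {0..P}"
      by (simp add: scaleR_diff_right)
    \<comment> \<open>One majorant for both cases: the first summand serves \<open>r\<close> near
      \<open>s\<close>, the constant serves \<open>r\<close> far from \<open>s\<close>.\<close>
    have int': "((\<lambda>r. K r * (e / 2) + e / 2) has_integral (P * (e / 2) + P * (e / 2))) {0..P}"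
      using has_integral_add[OF has_integral_mult_left[OF K, of "e/2"] has_integral_const_real[of "e/2" 0 P]] P
      by simp
    have bound: "norm (K r *\<^sub>R (u r - u s)) \<le> K r * (e / 2) + e / 2" if r: "r \<in> {0..P}" for r
    proof (cases "\<bar>r - s\<bar> < m")
      case True
      then have "norm (u r - u s) \<le> e / 2"
        using d(2)[of r s] r s m ab by (auto simp: dist_norm)
      then have "K r * norm (u r - u s) \<le> K r * (e / 2)"
        by (intro mult_left_mono) (auto simp: K_def cos_kernel_nonneg)
      then show ?thesis
        using e by (simp add: K_def cos_kernel_nonneg)
    next
      case False
      define x where "x = pi * \<bar>s - r\<bar> / P"
      have x: "pi * m / P \<le> x" "x \<le> pi - pi * m / P"
      proof -
        show "pi * m / P \<le> x"
          unfolding x_def using False P by (intro divide_right_mono mult_left_mono) auto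
        have "\<bar>s - r\<bar> \<le> P - m"
          using r s m ab by auto
        then have "x \<le> pi * (P - m) / P"
          unfolding x_def using P by (intro divide_right_mono mult_left_mono) auto
        then show "x \<le> pi - pi * m / P"
          using P by (simp add: diff_divide_distrib right_diff_distrib)
      qed
      have 0: "0 \<le> pi * m / P"
        using m P by simp
      have "cos x \<le> cos (pi * m / P)"
        using x 0 by (intro cos_monotone_0_pi_le) auto
      moreover have "cos (pi - pi * m / P) \<le> cos x"
        using x 0 by (intro cos_monotone_0_pi_le) auto
      ultimately have "\<bar>cos x\<bar> \<le> \<bar>cos (pi * m / P)\<bar>"
        by simp
      then have "(cos x)\<^sup>2 \<le> q"
        unfolding q_def by (simp add: abs_le_square_iff)
      moreover have "cos (2 * pi * (s - r) / P / 2) = cos x"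
      proof -
        have "2 * pi * (s - r) / P / 2 = pi * (s - r) / P"
          by simp
        moreover have "x = pi * (s - r) / P \<or> x = - (pi * (s - r) / P)"
          unfolding x_def by (simp add: abs_if diff_divide_distrib right_diff_distrib)
        ultimately show ?thesis
          by (metis cos_minus)
      qed
      ultimately have "K r \<le> 2 * real N * q ^ N"
        unfolding K_def using N by (intro cos_kernel_le) auto
      moreover have "norm (u r - u s) \<le> 2 * B"
        using norm_triangle_ineq4[of "u r" "u s"] B(2)[of r] B(2)[of s] r s ab by auto
      ultimately have "K r * norm (u r - u s) \<le> (2 * real N * q ^ N) * (2 * B)"
        using q by (intro mult_mono) auto
      also have "\<dots> \<le> K r * (e / 2) + e / 2"
        using N e by (auto simp: K_def algebra_simps intro!: add_increasing2 mult_nonneg_nonneg cos_kernel_nonneg)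
      finally show ?thesis
        by (simp add: K_def cos_kernel_nonneg)
    qed
    have "norm (P *\<^sub>R (trig_approx P u N s - u s)) \<le> P * (e / 2) + P * (e / 2)"
      using integral_norm_bound_integral[OF has_integral_integrable[OF int] has_integral_integrable[OF int'] bound]
      unfolding integral_unique[OF int] integral_unique[OF int'] .
    then show ?thesis
      using P by simp
  qed
  then show ?thesis by blast
qed

text \<open>
  Parseval's identity for \<open>u\<close> is only needed as an inequality, and only for functions vanishing
  near the ends of the period, so that no periodic extension has to be considered.
\<close>

lemma Plancherel_le:
  fixes u f :: "real \<Rightarrow> 'a::complex_hilbert_space"
  assumes P: "P > 0" and u: "continuous_on {0..P} u" and f: "continuous_on {0..P} f"
    and ab: "0 < a" "a \<le> b" "b < P" and supp: "\<And>s. s \<in> {0..P} \<Longrightarrow> s \<notin> {a..b} \<Longrightarrow> u s = 0"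
    and le: "\<And>k. norm (fourier_coeff P u k) \<le> M * norm (fourier_coeff P f k)"
  shows "integral {0..P} (\<lambda>s. (norm (u s))\<^sup>2) \<le> M\<^sup>2 * integral {0..P} (\<lambda>s. (norm (f s))\<^sup>2)"
proof -
  define I where "I = integral {0..P} (\<lambda>s. norm (u s))"
  have I: "I \<ge> 0"
    unfolding I_def by (rule integral_nonneg) (auto intro!: integrable_continuous_interval continuous_intros u)
  have "integral {0..P} (\<lambda>s. (norm (u s))\<^sup>2) \<le> M\<^sup>2 * integral {0..P} (\<lambda>s. (norm (f s))\<^sup>2) + e" if e: "e > 0" for e
  proof -
    \<comment> \<open>Tested against \<open>u\<close>, an approximation error of this size costs at
      most \<open>I * (e / (I + 1)) \<le> e\<close>; the 1 covers \<open>I = 0\<close>.\<close>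
    have "e / (I + 1) > 0"
      using e I by simp
    from trig_approx_uniform[OF P u ab this] obtain N
      where N: "\<forall>s\<in>{a..b}. norm (trig_approx P u N s - u s) \<le> e / (I + 1)" ..
    define c where "c j = norm (fourier_coeff P u (int j - int N))" for j
    have "((\<lambda>s. rinner (u s) (trig_approx P u N s)) has_integral
       (\<Sum>j\<le>2 * N. rinner (fourier_coeff P u (int j - int N))
           ((cos_weight N j / P) *\<^sub>R fourier_coeff P u (int j - int N)))) {0..P}"
      unfolding trig_approx_def by (intro has_integral_rinner_trig_sum P u) auto
    also have "(\<Sum>j\<le>2 * N. rinner (fourier_coeff P u (int j - int N))
           ((cos_weight N j / P) *\<^sub>R fourier_coeff P u (int j - int N))) = (\<Sum>j\<le>2 * N. cos_weight N j / P * (c j)\<^sup>2)"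
      by (simp add: rinner.scaleR_right rinner_self c_def)
    finally have Q: "((\<lambda>s. rinner (u s) (trig_approx P u N s)) has_integral
        (\<Sum>j\<le>2 * N. cos_weight N j / P * (c j)\<^sup>2)) {0..P}" .
    have "(\<Sum>j\<le>2 * N. cos_weight N j / P * (c j)\<^sup>2) \<le>
          (\<Sum>j\<le>2 * N. 1 / P * (M * norm (fourier_coeff P f (int j - int N)))\<^sup>2)"
      using P cos_weight_le_1[of N] le
      by (intro sum_mono mult_mono divide_right_mono power_mono) (auto simp: c_def)
    also have "\<dots> = M\<^sup>2 / P * (\<Sum>j\<le>2 * N. (norm (fourier_coeff P f (int j - int N)))\<^sup>2)"
      by (simp add: sum_distrib_left power_mult_distrib)
    also have "\<dots> \<le> M\<^sup>2 / P * (P * integral {0..P} (\<lambda>s. (norm (f s))\<^sup>2))"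
      using P by (intro mult_left_mono Bessel_inequality f) (auto simp: inj_on_def)
    finally have Q_le: "(\<Sum>j\<le>2 * N. cos_weight N j / P * (c j)\<^sup>2) \<le> M\<^sup>2 * integral {0..P} (\<lambda>s. (norm (f s))\<^sup>2)"
      using P by simp
    have uu: "(\<lambda>s. (norm (u s))\<^sup>2) integrable_on {0..P}"
      by (intro integrable_continuous_interval continuous_intros u)
    have un: "(\<lambda>s. norm (u s)) integrable_on {0..P}"
      by (intro integrable_continuous_interval continuous_intros u)
    have un': "(\<lambda>s. norm (u s) * (e / (I + 1))) integrable_on {0..P}"
      by (rule integrable_on_mult_left[OF un])
    have "integral {0..P} (\<lambda>s. (norm (u s))\<^sup>2) \<le>
       integral {0..P} (\<lambda>s. rinner (u s) (trig_approx P u N s) + norm (u s) * (e / (I + 1)))"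
    proof (rule integral_le)
      show "(\<lambda>s. rinner (u s) (trig_approx P u N s) + norm (u s) * (e / (I + 1))) integrable_on {0..P}"
        using Q un' by (intro integrable_add) auto
      show "(norm (u s))\<^sup>2 \<le> rinner (u s) (trig_approx P u N s) + norm (u s) * (e / (I + 1))"
        if s: "s \<in> {0..P}" for s
      proof (cases "s \<in> {a..b}")
        case True
        have "(norm (u s))\<^sup>2 = rinner (u s) (trig_approx P u N s) + rinner (u s) (u s - trig_approx P u N s)"
          by (simp add: rinner.diff_right rinner_self)
        also have "rinner (u s) (u s - trig_approx P u N s) \<le> norm (u s) * norm (u s - trig_approx P u N s)"
          by (rule rinner_le)
        also have "\<dots> \<le> norm (u s) * (e / (I + 1))"
          using bspec[OF N True] by (intro mult_left_mono) (auto simp: norm_minus_commute)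
        finally show ?thesis by simp
      next
        case False
        then show ?thesis
          using supp[OF s] by (simp add: rinner.zero_left)
      qed
    qed (rule uu)
    also have "\<dots> = (\<Sum>j\<le>2 * N. cos_weight N j / P * (c j)\<^sup>2) + I * (e / (I + 1))"
      using integral_add[OF has_integral_integrable[OF Q] un'] integral_unique[OF Q] by (simp add: I_def)
    also have "I * (e / (I + 1)) \<le> e"
      using I e by (simp add: field_simps)
    finally show ?thesis
      using Q_le by simp
  qed
  then show ?thesis
    by (rule field_le_epsilon)
qed

subsection \<open>The generator and the resolvent bound\<close>

text \<open>Turns a derivative into the one-sided limit used in \<open>is_generator\<close>.\<close>

lemma has_vector_derivative_at_right_0:
  assumes "(F has_vector_derivative y) (at 0 within {0..})"
  shows "((\<lambda>h. (F h - F 0) /\<^sub>R h) \<longlongrightarrow> y) (at_right 0)"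
proof -
  have "((\<lambda>h. ((F h - F 0) - h *\<^sub>R y) /\<^sub>R norm h) \<longlongrightarrow> 0) (at_right 0)"
    using assms by (simp add: has_vector_derivative_def has_derivative_at_within at_within_Ici_at_right)
  moreover have "eventually (\<lambda>h. ((F h - F 0) - h *\<^sub>R y) /\<^sub>R norm h = (F h - F 0) /\<^sub>R h - y) (at_right 0)"
    unfolding eventually_at_right_field
    by (intro exI[of _ 1]) (auto simp: scaleR_diff_right)
  ultimately have "((\<lambda>h. (F h - F 0) /\<^sub>R h - y) \<longlongrightarrow> 0) (at_right 0)"
    by (rule Lim_transform_eventually)
  then show ?thesis
    by (simp add: LIM_zero_iff)
qed

context strongly_continuous_semigroup
begin

text \<open>
  Averages of an orbit against a smooth compactly supported weight lie in the domain of the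
  generator, which acts on them by differentiating the weight.
\<close>

lemma generator_weighted_orbit:
  fixes g g' :: "real \<Rightarrow> complex" and x :: 'a
  assumes gen: "is_generator T D (\<lambda>x. - A x)"
    and g: "\<And>s. (g has_vector_derivative g' s) (at s)" and g': "continuous_on UNIV g'"
    and ab: "0 \<le> a" "b < P" and supp: "\<And>s. s \<notin> {a..b} \<Longrightarrow> g s = 0"
  defines "v \<equiv> integral {0..P} (\<lambda>s. g s *\<^sub>C T s x)"
  shows "v \<in> D" and "A v = integral {0..P} (\<lambda>s. g' s *\<^sub>C T s x)"
proof -
  \<comment> \<open>Substitution turns \<open>T h v\<close> into an average against the translated
    weight. The derivative in \<open>h\<close> then falls on \<open>g\<close>, so the orbit itself
    need not be differentiable.\<close>
  define F where "F h = integral {0..P} (\<lambda>s. g (s - h) *\<^sub>C T s x)" for h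
  have cont_g: "continuous_on S g" for S
    using g by (intro continuous_at_imp_continuous_on ballI has_vector_derivative_continuous)
  have [continuous_intros]: "continuous_on S (\<lambda>s. g (f s))" if "continuous_on S f" for S f
    using continuous_on_compose2[OF cont_g that] by auto
  have [continuous_intros]: "continuous_on S (\<lambda>s. g' (f s))" if "continuous_on S f" for S and f :: "'z::topological_space \<Rightarrow> real"
    using continuous_on_compose2[OF g' that] by auto
  have T_v: "T h v = F h" if h: "0 \<le> h" "h < P - b" for h
  proof -
    have "(\<lambda>s. g s *\<^sub>C T s x) integrable_on {0..P}"
      by (intro integrable_continuous_interval continuous_intros) auto
    then have "((\<lambda>s. g s *\<^sub>C T s x) has_integral v) {0..P}"
      unfolding v_def by (rule integrable_integral)
    from has_integral_linear[OF this bounded_linear_T[OF h(1)]]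
    have "((\<lambda>s. T h (g s *\<^sub>C T s x)) has_integral T h v) {0..P}"
      by (simp add: o_def)
    then have "((\<lambda>s. g s *\<^sub>C T (s + h) x) has_integral T h v) {0..P}"
    proof (rule has_integral_eq[rotated])
      fix s assume s: "s \<in> {0..P}"
      have "T (s + h) x = T h (T s x)"
        by (subst add.commute) (use s h in \<open>simp add: T_add\<close>)
      then show "T h (g s *\<^sub>C T s x) = g s *\<^sub>C T (s + h) x"
        using h by (simp add: T_scaleC)
    qed
    from has_integral_shift_real_ivl[OF this, of "- h"]
    have "((\<lambda>s. g (s - h) *\<^sub>C T s x) has_integral T h v) {h..P + h}"
      by simp
    \<comment> \<open>For \<open>h < P - b\<close> the support of the translated weight lies in both
      \<open>{h..P + h}\<close> and \<open>{0..P}\<close>, so the two integrals agree.\<close>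
    moreover have "(if s \<in> {h..P + h} then g (s - h) *\<^sub>C T s x else 0) = g (s - h) *\<^sub>C T s x" for s
      using supp[of "s - h"] ab h by (auto simp: scaleC.zero_left)
    moreover have "(if s \<in> {0..P} then g (s - h) *\<^sub>C T s x else 0) = g (s - h) *\<^sub>C T s x" for s
      using supp[of "s - h"] ab h by (auto simp: scaleC.zero_left)
    ultimately have "((\<lambda>s. g (s - h) *\<^sub>C T s x) has_integral T h v) {0..P}"
      using has_integral_restrict_UNIV[of "{h..P + h}" "\<lambda>s. g (s - h) *\<^sub>C T s x" "T h v"]
        has_integral_restrict_UNIV[of "{0..P}" "\<lambda>s. g (s - h) *\<^sub>C T s x" "T h v"] by simp
    then show ?thesis
      unfolding F_def by (simp add: integral_unique)
  qed
  have "((\<lambda>h. integral (cbox 0 P) (\<lambda>s. g (s - h) *\<^sub>C T s x)) has_vector_derivative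
          integral (cbox 0 P) (\<lambda>s. (- g' (s - 0)) *\<^sub>C T s x)) (at 0 within {0..})"
  proof (rule leibniz_rule_vector_derivative)
    fix h s :: real
    have "((\<lambda>h. s - h) has_vector_derivative - 1) (at h within {0..})"
      by (auto intro!: derivative_eq_intros)
    from vector_diff_chain_within[OF this has_vector_derivative_at_within[OF g]]
    have "((\<lambda>h. g (s - h)) has_vector_derivative - g' (s - h)) (at h within {0..})"
      by (simp add: o_def)
    then show "((\<lambda>h. g (s - h) *\<^sub>C T s x) has_vector_derivative (- g' (s - h)) *\<^sub>C T s x) (at h within {0..})"
      using bounded_linear.has_vector_derivative[OF scaleC.bounded_linear_left] by blast
    show "(\<lambda>s. g (s - h) *\<^sub>C T s x) integrable_on cbox 0 P"
      unfolding cbox_interval by (intro integrable_continuous_interval continuous_intros) auto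
    show "continuous_on ({0..} \<times> cbox 0 P) (\<lambda>(h, s). (- g' (s - h)) *\<^sub>C T s x)"
      unfolding split_beta by (intro continuous_intros) auto
  qed auto
  then have "(F has_vector_derivative - integral {0..P} (\<lambda>s. g' s *\<^sub>C T s x)) (at 0 within {0..})"
    by (simp add: F_def[abs_def] scaleC.minus_left)
  from has_vector_derivative_at_right_0[OF this]
  have "((\<lambda>h. (F h - F 0) /\<^sub>R h) \<longlongrightarrow> - integral {0..P} (\<lambda>s. g' s *\<^sub>C T s x)) (at_right 0)" .
  then have "((\<lambda>h. (F h - v) /\<^sub>R h) \<longlongrightarrow> - integral {0..P} (\<lambda>s. g' s *\<^sub>C T s x)) (at_right 0)"
    by (simp add: F_def v_def)
  moreover have "eventually (\<lambda>h. (F h - v) /\<^sub>R h = (T h v - v) /\<^sub>R h) (at_right 0)"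
    unfolding eventually_at_right_field
    by (intro exI[of _ "P - b"]) (use ab T_v in auto)
  ultimately have lim: "((\<lambda>h. (T h v - v) /\<^sub>R h) \<longlongrightarrow> - integral {0..P} (\<lambda>s. g' s *\<^sub>C T s x)) (at_right 0)"
    by (rule Lim_transform_eventually)
  then show D: "v \<in> D"
    using gen by (auto simp: is_generator_def)
  then have "((\<lambda>h. (T h v - v) /\<^sub>R h) \<longlongrightarrow> - A v) (at_right 0)"
    using gen by (auto simp: is_generator_def)
  then show "A v = integral {0..P} (\<lambda>s. g' s *\<^sub>C T s x)"
    using tendsto_unique[OF trivial_limit_at_right_real lim] by force
qed

end

text \<open>Off the spectrum \<open>v\<close> is the resolvent applied to
  \<open>l *\<^sub>C v - A v\<close>. This a priori form is the one applied to Fourier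
  coefficients.\<close>

lemma Kreiss_bounded_resolvent:
  assumes "Kreiss_bounded \<alpha> T"
  obtains D A C where "is_generator T D (\<lambda>x. - A x)" "C > 0"
    "\<And>l v. Re l < 0 \<Longrightarrow> v \<in> D \<Longrightarrow> norm v \<le> C / (- Re l) powr \<alpha> * norm (l *\<^sub>C v - A v)"
proof -
  obtain D A C where gen: "is_generator T D (\<lambda>x. - A x)" and spec: "spectrum D A \<subseteq> {l. Re l \<ge> 0}"
    and C: "C > 0" "\<And>l. Re l < 0 \<Longrightarrow> onorm (resolvent D A l) \<le> C / (- Re l) powr \<alpha>"
    using assms unfolding Kreiss_bounded_def by blast
  have "norm v \<le> C / (- Re l) powr \<alpha> * norm (l *\<^sub>C v - A v)" if l: "Re l < 0" and v: "v \<in> D" for l v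
  proof -
    have "l \<notin> spectrum D A"
      using spec l by auto
    then have bij: "bij_betw (\<lambda>x. l *\<^sub>C x - A x) D UNIV" and lin: "bounded_linear (resolvent D A l)"
      by (auto simp: spectrum_def bounded_clinear_def)
    have "v = resolvent D A l (l *\<^sub>C v - A v)"
      unfolding resolvent_def using inv_into_f_f[OF bij_betw_imp_inj_on[OF bij] v] by simp
    then have "norm v \<le> onorm (resolvent D A l) * norm (l *\<^sub>C v - A v)"
      using onorm[OF lin] by metis
    also have "\<dots> \<le> C / (- Re l) powr \<alpha> * norm (l *\<^sub>C v - A v)"
      using C(2)[OF l] by (intro mult_right_mono) auto
    finally show ?thesis .
  qed
  with gen C(1) show ?thesis
    using that by blast
qed

locale Kreiss_semigroup = strongly_continuous_semigroup T
  for T :: "real \<Rightarrow> 'a::complex_hilbert_space \<Rightarrow> 'a" +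
  fixes D :: "'a set" and A :: "'a \<Rightarrow> 'a" and C \<alpha> :: real
  assumes gen: "is_generator T D (\<lambda>x. - A x)" and C_pos: "C > 0"
    and resolvent_bound:
      "\<And>l v. Re l < 0 \<Longrightarrow> v \<in> D \<Longrightarrow> norm v \<le> C / (- Re l) powr \<alpha> * norm (l *\<^sub>C v - A v)"
begin

definition energy :: "real \<Rightarrow> 'a \<Rightarrow> real \<Rightarrow> real" where
  "energy e x s = (exp (- e * s) * norm (T s x))\<^sup>2"

lemma energy_nonneg: "energy e x s \<ge> 0"
  by (simp add: energy_def)

lemma continuous_on_energy [continuous_intros]:
  "S \<subseteq> {0..} \<Longrightarrow> continuous_on S (energy e x)"
  unfolding energy_def[abs_def] by (intro continuous_intros) auto

text \<open>
  With \<open>u s = \<Phi> s e\<^sup>-\<^sup>e\<^sup>s T s x\<close> and \<open>f s = \<Phi>' s e\<^sup>-\<^sup>e\<^sup>s T s x\<close> the equation \<open>u' + (A + e) u = f\<close> turns into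
  \<open>(i \<theta> + A + e) u\<^sub>k = f\<^sub>k\<close> for the Fourier coefficients.
\<close>

lemma energy_inequality:
  fixes \<Phi> \<Phi>' :: "real \<Rightarrow> real" and x :: 'a
  assumes e: "e > 0" and deriv: "\<And>s. (\<Phi> has_real_derivative \<Phi>' s) (at s)"
    and cont: "continuous_on UNIV \<Phi>'"
    and ab: "0 < a" "a \<le> b" "b < P" and supp: "\<And>s. s \<notin> {a..b} \<Longrightarrow> \<Phi> s = 0"
  shows "integral {0..P} (\<lambda>s. (\<Phi> s)\<^sup>2 * energy e x s) \<le>
     (C / e powr \<alpha>)\<^sup>2 * integral {0..P} (\<lambda>s. (\<Phi>' s)\<^sup>2 * energy e x s)"
proof -
  define u where "u s = (\<Phi> s * exp (- e * s)) *\<^sub>R T s x" for s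
  define f where "f s = (\<Phi>' s * exp (- e * s)) *\<^sub>R T s x" for s
  have P: "P > 0"
    using ab by simp
  have cont\<Phi>: "continuous_on S \<Phi>" for S
    using deriv by (intro continuous_at_imp_continuous_on ballI DERIV_isCont)
  have cont\<Phi>': "continuous_on S \<Phi>'" for S
    using cont by (rule continuous_on_subset) auto
  have cont_u: "continuous_on {0..P} u" and cont_f: "continuous_on {0..P} f"
    unfolding u_def[abs_def] f_def[abs_def] by (intro continuous_intros cont\<Phi> cont\<Phi>'; auto)+
  have le: "norm (fourier_coeff P u k) \<le> C / e powr \<alpha> * norm (fourier_coeff P f k)" for k
  proof -
    \<comment> \<open>The resolvent bound is used at \<open>- z\<close>, on the line
      \<open>Re l = - e\<close> at the k-th frequency. Accordingly \<open>E\<close> merges the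
      damping factor with the Fourier character.\<close>
    define z where "z = Complex e (2 * pi * of_int k / P)"
    define E where "E s = exp (- z * of_real s)" for s :: real
    define g where "g s = of_real (\<Phi> s) * E s" for s
    define g' where "g' s = of_real (\<Phi>' s) * E s - z * g s" for s
    have E: "E s = of_real (exp (- e * s)) * cis (- (2 * pi * of_int k * s / P))" for s
      by (simp add: E_def z_def exp_eq_polar)
    have "(E has_vector_derivative - z * E s) (at s)" for s
      unfolding E_def[abs_def]
      by (rule has_vector_derivative_real_field) (auto intro!: derivative_eq_intros)
    moreover have "((\<lambda>s. complex_of_real (\<Phi> s)) has_vector_derivative of_real (\<Phi>' s)) (at s)" for s
      using deriv by (intro has_vector_derivative_of_real) (simp add: has_real_derivative_iff_has_vector_derivative)
    ultimately have "((\<lambda>s. of_real (\<Phi> s) * E s) has_vector_derivative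
        of_real (\<Phi> s) * (- z * E s) + of_real (\<Phi>' s) * E s) (at s)" for s
      by (intro has_vector_derivative_mult)
    then have g: "(g has_vector_derivative g' s) (at s)" for s
      by (simp add: g_def[abs_def] g'_def algebra_simps)
    have contE: "continuous_on S E" for S
      unfolding E_def[abs_def] by (intro continuous_intros)
    have g': "continuous_on UNIV g'"
      unfolding g'_def[abs_def] g_def[abs_def]
      by (intro continuous_intros contE cont\<Phi> cont\<Phi>')
    have u_k: "fourier_coeff P u k = integral {0..P} (\<lambda>s. g s *\<^sub>C T s x)"
      unfolding fourier_coeff_def u_def g_def E
      by (simp add: scaleC_scaleC mult_ac flip: scaleC_of_real)
    have f_k: "fourier_coeff P f k = integral {0..P} (\<lambda>s. (of_real (\<Phi>' s) * E s) *\<^sub>C T s x)"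
      unfolding fourier_coeff_def f_def E
      by (simp add: scaleC_scaleC mult_ac flip: scaleC_of_real)
    have supp': "g s = 0" if "s \<notin> {a..b}" for s
      using supp[OF that] by (simp add: g_def)
    note gw = generator_weighted_orbit[OF gen g g' less_imp_le[OF ab(1)] ab(3) supp', where x = x, folded u_k]
    have int_g: "((\<lambda>s. g s *\<^sub>C T s x) has_integral fourier_coeff P u k) {0..P}"
      unfolding u_k g_def
      by (intro integrable_integral integrable_continuous_interval continuous_intros cont\<Phi> contE) auto
    have int_f: "((\<lambda>s. (of_real (\<Phi>' s) * E s) *\<^sub>C T s x) has_integral fourier_coeff P f k) {0..P}"
      unfolding f_k
      by (intro integrable_integral integrable_continuous_interval continuous_intros cont\<Phi>' contE) auto
    have "((\<lambda>s. z *\<^sub>C g s *\<^sub>C T s x) has_integral z *\<^sub>C fourier_coeff P u k) {0..P}"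
      using has_integral_linear[OF int_g scaleC.bounded_linear_right[of z]] by (simp add: o_def)
    from has_integral_diff[OF int_f this]
    have "((\<lambda>s. g' s *\<^sub>C T s x) has_integral fourier_coeff P f k - z *\<^sub>C fourier_coeff P u k) {0..P}"
      by (simp add: g'_def scaleC.diff_left scaleC_scaleC)
    with gw(2) have "A (fourier_coeff P u k) = fourier_coeff P f k - z *\<^sub>C fourier_coeff P u k"
      by (simp add: integral_unique)
    then have "(- z) *\<^sub>C fourier_coeff P u k - A (fourier_coeff P u k) = - fourier_coeff P f k"
      by (simp add: scaleC.minus_left)
    then show ?thesis
      using resolvent_bound[of "- z" "fourier_coeff P u k"] gw(1) e by (simp add: z_def)
  qed
  have "integral {0..P} (\<lambda>s. (norm (u s))\<^sup>2) \<le>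
      (C / e powr \<alpha>)\<^sup>2 * integral {0..P} (\<lambda>s. (norm (f s))\<^sup>2)"
    using P cont_u cont_f ab _ le
    by (rule Plancherel_le) (use supp in \<open>auto simp: u_def\<close>)
  then show ?thesis
    by (simp add: u_def f_def energy_def power_mult_distrib mult_ac)
qed

end

subsection \<open>Propagation of energy along orbits\<close>

lemma DERIV_max_0_squared: "((\<lambda>s. (max 0 s)\<^sup>2) has_real_derivative 2 * max 0 s) (at s)"
proof -
  consider "s > 0" | "s < 0" | "s = 0" by linarith
  then show ?thesis
  proof cases
    case 1
    have "((\<lambda>s. s\<^sup>2) has_real_derivative 2 * max 0 s) (at s)"
      using 1 by (auto intro!: derivative_eq_intros)
    then show ?thesis
      by (rule has_field_derivative_transform_within_open[where S = "{0<..}"]) (use 1 in auto)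
  next
    case 2
    have "((\<lambda>s. 0) has_real_derivative 2 * max 0 s) (at s)"
      using 2 by simp
    then show ?thesis
      by (rule has_field_derivative_transform_within_open[where S = "{..<0}"]) (use 2 in auto)
  next
    case 3
    have "((\<lambda>h. max 0 h) \<longlongrightarrow> max 0 0) (at (0::real))"
      by (intro tendsto_intros)
    moreover have "eventually (\<lambda>h. max 0 h = (max 0 h)\<^sup>2 / h) (at (0::real))"
      by (auto simp: eventually_at max_def power2_eq_square intro!: exI[of _ 1])
    ultimately have "((\<lambda>h. (max 0 h)\<^sup>2 / h) \<longlongrightarrow> max 0 0) (at (0::real))"
      by (rule Lim_transform_eventually)
    then show ?thesis
      using 3 by (simp add: DERIV_def)
  qed
qed

text \<open>A quadratic spline with knots 0, 1/2, 1, written in truncated powers so that one formula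
  holds on the whole line. Its derivative is a continuous tent of height 2, regular enough for
  \<open>energy_inequality\<close>.\<close>

definition smooth_step :: "real \<Rightarrow> real" where
  "smooth_step s = 2 * (max 0 s)\<^sup>2 - 4 * (max 0 (s - 1/2))\<^sup>2 + 2 * (max 0 (s - 1))\<^sup>2"

definition smooth_step' :: "real \<Rightarrow> real" where
  "smooth_step' s = 4 * max 0 s - 8 * max 0 (s - 1/2) + 4 * max 0 (s - 1)"

lemma DERIV_smooth_step [derivative_intros]:
  assumes "(f has_real_derivative f') (at s)"
  shows "((\<lambda>s. smooth_step (f s)) has_real_derivative smooth_step' (f s) * f') (at s)"
proof -
  have shift: "((\<lambda>s. (max 0 (s - k))\<^sup>2) has_real_derivative 2 * max 0 (s - k)) (at s)" for s k :: real
  proof -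
    have "((\<lambda>s. s - k) has_real_derivative 1) (at s)"
      by (auto intro!: derivative_eq_intros)
    from DERIV_chain2[OF DERIV_max_0_squared this] show ?thesis
      by simp
  qed
  have "((\<lambda>s. 2 * (max 0 (s - 0))\<^sup>2 - 4 * (max 0 (s - 1/2))\<^sup>2 + 2 * (max 0 (s - 1))\<^sup>2) has_real_derivative
      2 * (2 * max 0 (s - 0)) - 4 * (2 * max 0 (s - 1/2)) + 2 * (2 * max 0 (s - 1))) (at s)" for s :: real
    by (intro DERIV_add DERIV_diff DERIV_cmult shift)
  then have "(smooth_step has_real_derivative smooth_step' s) (at s)" for s
    by (simp add: smooth_step_def[abs_def] smooth_step'_def)
  then show ?thesis
    using assms by (rule DERIV_chain2)
qed

lemma continuous_on_smooth_step' [continuous_intros]: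
  "continuous_on S f \<Longrightarrow> continuous_on S (\<lambda>s. smooth_step' (f s))"
  unfolding smooth_step'_def by (intro continuous_intros)

lemma continuous_on_smooth_step [continuous_intros]:
  "continuous_on S f \<Longrightarrow> continuous_on S (\<lambda>s. smooth_step (f s))"
  unfolding smooth_step_def by (intro continuous_intros)

lemma smooth_step_eq_0: "s \<le> 0 \<Longrightarrow> smooth_step s = 0"
  by (simp add: smooth_step_def)

lemma smooth_step_eq_1: "s \<ge> 1 \<Longrightarrow> smooth_step s = 1"
  by (simp add: smooth_step_def power2_eq_square algebra_simps)

lemma smooth_step'_eq_0: "s \<le> 0 \<or> s \<ge> 1 \<Longrightarrow> smooth_step' s = 0"
  by (auto simp: smooth_step'_def)

lemma smooth_step_bounds: "0 \<le> smooth_step s" "smooth_step s \<le> 1"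
proof -
  consider "s \<le> 0" | "0 \<le> s" "s \<le> 1/2" | "1/2 \<le> s" "s \<le> 1" | "s \<ge> 1" by linarith
  then have "0 \<le> smooth_step s \<and> smooth_step s \<le> 1"
  proof cases
    case 2
    then have eq: "smooth_step s = 2 * s\<^sup>2"
      by (simp add: smooth_step_def)
    have "s\<^sup>2 \<le> (1/2)\<^sup>2"
      using 2 by (intro power_mono) auto
    then show ?thesis
      by (simp add: eq power2_eq_square)
  next
    case 3
    then have eq: "smooth_step s = 1 - 2 * (1 - s)\<^sup>2"
      by (simp add: smooth_step_def power2_eq_square algebra_simps)
    have "(1 - s)\<^sup>2 \<le> (1/2)\<^sup>2"
      using 3 by (intro power_mono) auto
    then show ?thesis
      by (simp add: eq power2_eq_square)
  qed (auto simp: smooth_step_eq_0 smooth_step_eq_1)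
  then show "0 \<le> smooth_step s" "smooth_step s \<le> 1" by auto
qed

lemma smooth_step'_bound: "\<bar>smooth_step' s\<bar> \<le> 2"
  by (auto simp: smooth_step'_def max_def)

lemma integral_eq_if_zero_outside:
  fixes f :: "'a::euclidean_space \<Rightarrow> 'b::banach"
  assumes "\<And>s. s \<notin> S \<inter> S' \<Longrightarrow> f s = 0"
  shows "integral S f = integral S' f"
proof -
  have "(\<lambda>s. if s \<in> S then f s else 0) = f" "(\<lambda>s. if s \<in> S' then f s else 0) = f"
    using assms by auto
  then show ?thesis
    using integral_restrict_UNIV[of S f] integral_restrict_UNIV[of S' f] by simp
qed

section \<open>The energy inequality with cut-offs\<close>

context Kreiss_semigroup
begin

definition resolvent_const :: "real \<Rightarrow> real" where
  "resolvent_const e = C / e powr \<alpha>"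

text \<open>Apply \<open>energy_inequality\<close> to \<open>r * \<psi> * c\<close>, where
  \<open>r\<close> rises on \<open>{a..b}\<close> and \<open>c\<close> falls on
  \<open>{R..R+1}\<close>. The derivative of \<open>r\<close> yields the initial window, that of
  \<open>c\<close> the end term, and that of \<open>\<psi>\<close> is absorbed by the left
  side.\<close>

lemma energy_propagation_finite:
  fixes \<psi> \<psi>' :: "real \<Rightarrow> real" and x :: 'a
  assumes e: "e > 0" and deriv: "\<And>s. (\<psi> has_real_derivative \<psi>' s) (at s)"
    and cont: "continuous_on UNIV \<psi>'"
    and \<psi>: "\<And>s. 0 \<le> \<psi> s" "\<And>s. \<psi> s \<le> 1" "\<And>s. \<bar>\<psi>' s\<bar> \<le> d * \<psi> s"
    and small: "6 * (resolvent_const e)\<^sup>2 * d\<^sup>2 \<le> 1"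
    and ab: "0 < a" "a < b" "b \<le> R"
  shows "integral {b..R} (\<lambda>s. (\<psi> s)\<^sup>2 * energy e x s) \<le>
     24 * (resolvent_const e)\<^sup>2 * (integral {a..b} (energy e x) / (b - a)\<^sup>2 + integral {R..R+1} (\<lambda>s. (\<psi> s)\<^sup>2 * energy e x s))"
proof -
  define r where "r s = smooth_step ((s - a) / (b - a))" for s
  define r' where "r' s = smooth_step' ((s - a) / (b - a)) / (b - a)" for s
  define c where "c s = smooth_step (R + 1 - s)" for s
  define c' where "c' s = smooth_step' (R + 1 - s)" for s
  define \<Phi> where "\<Phi> s = r s * \<psi> s * c s" for s
  define \<Phi>' where "\<Phi>' s = r' s * \<psi> s * c s + r s * \<psi>' s * c s - r s * \<psi> s * c' s" for s
  \<comment> \<open>Leaves room after the support \<open>{a..R+1}\<close>, as the Fourier argument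
    requires.\<close>
  define P where "P = R + 2"
  define J where "J = integral {0..P} (\<lambda>s. (\<Phi> s)\<^sup>2 * energy e x s)"
  have cont\<psi>: "continuous_on S \<psi>" for S
    using deriv by (intro continuous_at_imp_continuous_on ballI DERIV_isCont)
  have cont\<psi>': "continuous_on S \<psi>'" for S
    using cont by (rule continuous_on_subset) auto
  have conts: "continuous_on S r" "continuous_on S r'" "continuous_on S c" "continuous_on S c'" for S
    unfolding r_def[abs_def] r'_def[abs_def] c_def[abs_def] c'_def[abs_def] using ab
    by (intro continuous_intros; simp)+
  have cont\<Phi>: "continuous_on S \<Phi>" "continuous_on S \<Phi>'" for S
    unfolding \<Phi>_def[abs_def] \<Phi>'_def[abs_def] by (intro continuous_intros conts cont\<psi> cont\<psi>')+
  have "(r has_real_derivative r' s) (at s)" for s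
    unfolding r_def[abs_def] r'_def using ab by (auto intro!: derivative_eq_intros)
  moreover have "(c has_real_derivative - c' s) (at s)" for s
    unfolding c_def[abs_def] c'_def by (auto intro!: derivative_eq_intros)
  ultimately have deriv\<Phi>: "(\<Phi> has_real_derivative \<Phi>' s) (at s)" for s
    unfolding \<Phi>_def[abs_def] \<Phi>'_def by (auto intro!: derivative_eq_intros deriv simp: algebra_simps)
  have supp: "\<Phi> s = 0" if "s \<notin> {a..R+1}" for s
  proof -
    from that have "s < a \<or> s > R + 1" by auto
    then have "r s = 0 \<or> c s = 0"
      using ab by (auto simp: r_def c_def intro!: smooth_step_eq_0 divide_nonpos_pos)
    then show ?thesis
      by (auto simp: \<Phi>_def)
  qed
  have bounds: "0 \<le> r s" "r s \<le> 1" "0 \<le> c s" "c s \<le> 1" for s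
    by (auto simp: r_def c_def smooth_step_bounds)
  have "J \<le> (resolvent_const e)\<^sup>2 * integral {0..P} (\<lambda>s. (\<Phi>' s)\<^sup>2 * energy e x s)"
    unfolding J_def resolvent_const_def using ab
    by (intro energy_inequality[where a = a and b = "R + 1"] e deriv\<Phi> cont\<Phi> supp) (auto simp: P_def)
  also have "integral {0..P} (\<lambda>s. (\<Phi>' s)\<^sup>2 * energy e x s) \<le>
     integral {0..P} (\<lambda>s. 3 * d\<^sup>2 * ((\<Phi> s)\<^sup>2 * energy e x s) +
        3 * ((r' s * \<psi> s * c s)\<^sup>2 * energy e x s) + 3 * ((r s * \<psi> s * c' s)\<^sup>2 * energy e x s))"
  proof (rule integral_le)
    fix s
    have "(p + q - t)\<^sup>2 \<le> 3 * q\<^sup>2 + 3 * p\<^sup>2 + 3 * t\<^sup>2" for p q t :: real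
    proof -
      have "0 \<le> (p - q)\<^sup>2 + (p + t)\<^sup>2 + (q + t)\<^sup>2"
        by simp
      then show ?thesis
        by (simp add: power2_eq_square algebra_simps)
    qed
    then have "(\<Phi>' s)\<^sup>2 \<le> 3 * (r s * \<psi>' s * c s)\<^sup>2 + 3 * (r' s * \<psi> s * c s)\<^sup>2 + 3 * (r s * \<psi> s * c' s)\<^sup>2"
      unfolding \<Phi>'_def .
    also have "(r s * \<psi>' s * c s)\<^sup>2 \<le> (d * \<Phi> s)\<^sup>2"
    proof -
      have "r s * c s * \<bar>\<psi>' s\<bar> \<le> r s * c s * (d * \<psi> s)"
        using bounds[of s] \<psi>(3) by (intro mult_left_mono) auto
      then have "\<bar>r s * \<psi>' s * c s\<bar> \<le> d * \<Phi> s"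
        using bounds[of s] by (simp add: abs_mult \<Phi>_def mult_ac)
      then have "\<bar>r s * \<psi>' s * c s\<bar> \<le> \<bar>d * \<Phi> s\<bar>"
        by linarith
      then show ?thesis
        by (simp only: abs_le_square_iff)
    qed
    finally have "(\<Phi>' s)\<^sup>2 * energy e x s \<le>
       (3 * (d * \<Phi> s)\<^sup>2 + 3 * (r' s * \<psi> s * c s)\<^sup>2 + 3 * (r s * \<psi> s * c' s)\<^sup>2) * energy e x s"
      by (intro mult_right_mono) (auto simp: energy_nonneg)
    then show "(\<Phi>' s)\<^sup>2 * energy e x s \<le> 3 * d\<^sup>2 * ((\<Phi> s)\<^sup>2 * energy e x s) +
        3 * ((r' s * \<psi> s * c s)\<^sup>2 * energy e x s) + 3 * ((r s * \<psi> s * c' s)\<^sup>2 * energy e x s)"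
      by (simp add: power_mult_distrib algebra_simps)
  qed (intro integrable_continuous_interval continuous_intros cont\<Phi> conts cont\<psi>; auto)+
  also have "\<dots> = 3 * d\<^sup>2 * J + 3 * integral {0..P} (\<lambda>s. (r' s * \<psi> s * c s)\<^sup>2 * energy e x s)
       + 3 * integral {0..P} (\<lambda>s. (r s * \<psi> s * c' s)\<^sup>2 * energy e x s)"
  proof -
    have 1: "(\<lambda>s. (\<Phi> s)\<^sup>2 * energy e x s) integrable_on {0..P}"
      and 2: "(\<lambda>s. (r' s * \<psi> s * c s)\<^sup>2 * energy e x s) integrable_on {0..P}"
      and 3: "(\<lambda>s. (r s * \<psi> s * c' s)\<^sup>2 * energy e x s) integrable_on {0..P}"
      by (intro integrable_continuous_interval continuous_intros cont\<Phi> conts cont\<psi>; auto)+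
    show ?thesis
      unfolding J_def
      by (intro integral_unique has_integral_add has_integral_mult_right integrable_integral 1 2 3)
  qed
  also have "integral {0..P} (\<lambda>s. (r' s * \<psi> s * c s)\<^sup>2 * energy e x s) \<le> 4 / (b - a)\<^sup>2 * integral {a..b} (energy e x)"
  proof -
    have "integral {0..P} (\<lambda>s. (r' s * \<psi> s * c s)\<^sup>2 * energy e x s) =
        integral {a..b} (\<lambda>s. (r' s * \<psi> s * c s)\<^sup>2 * energy e x s)"
    proof (rule integral_eq_if_zero_outside)
      fix s assume "s \<notin> {0..P} \<inter> {a..b}"
      then have "s \<le> a \<or> s \<ge> b"
        using ab by (auto simp: P_def)
      then have "r' s = 0"
        using ab by (auto simp: r'_def divide_simps smooth_step'_eq_0)
      then show "(r' s * \<psi> s * c s)\<^sup>2 * energy e x s = 0" by simp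
    qed
    also have "\<dots> \<le> integral {a..b} (\<lambda>s. 4 / (b - a)\<^sup>2 * energy e x s)"
    proof (rule integral_le)
      fix s
      have "\<bar>r' s\<bar> \<le> 2 / (b - a)"
        using smooth_step'_bound[of "(s - a) / (b - a)"] ab by (auto simp: r'_def abs_divide intro!: divide_right_mono)
      then have "\<bar>r' s\<bar> * (\<psi> s * c s) \<le> 2 / (b - a) * 1"
        using \<psi>[of s] bounds[of s] ab by (intro mult_mono mult_le_one) auto
      then have "\<bar>r' s * \<psi> s * c s\<bar> \<le> 2 / (b - a)"
        using \<psi>[of s] bounds[of s] by (simp add: abs_mult mult_ac)
      then have "\<bar>r' s * \<psi> s * c s\<bar>\<^sup>2 \<le> (2 / (b - a))\<^sup>2"
        by (intro power_mono) auto
      then show "(r' s * \<psi> s * c s)\<^sup>2 * energy e x s \<le> 4 / (b - a)\<^sup>2 * energy e x s"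
        by (intro mult_right_mono) (auto simp: energy_nonneg power_divide)
    qed (use ab in \<open>intro integrable_continuous_interval continuous_intros cont\<Phi> conts cont\<psi>; auto\<close>)+
    finally show ?thesis by simp
  qed
  also have "integral {0..P} (\<lambda>s. (r s * \<psi> s * c' s)\<^sup>2 * energy e x s) \<le>
      4 * integral {R..R+1} (\<lambda>s. (\<psi> s)\<^sup>2 * energy e x s)"
  proof -
    have "integral {0..P} (\<lambda>s. (r s * \<psi> s * c' s)\<^sup>2 * energy e x s) =
        integral {R..R+1} (\<lambda>s. (r s * \<psi> s * c' s)\<^sup>2 * energy e x s)"
    proof (rule integral_eq_if_zero_outside)
      fix s assume "s \<notin> {0..P} \<inter> {R..R+1}"
      then have "s \<le> R \<or> s \<ge> R + 1"
        using ab by (auto simp: P_def)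
      then have "c' s = 0"
        using ab by (auto simp: c'_def smooth_step'_eq_0)
      then show "(r s * \<psi> s * c' s)\<^sup>2 * energy e x s = 0" by simp
    qed
    also have "\<dots> \<le> integral {R..R+1} (\<lambda>s. 4 * ((\<psi> s)\<^sup>2 * energy e x s))"
    proof (rule integral_le)
      fix s
      have "r s * \<bar>c' s\<bar> \<le> 1 * 2"
        using bounds[of s] by (intro mult_mono) (auto simp: c'_def smooth_step'_bound)
      then have "r s * \<bar>c' s\<bar> * \<psi> s \<le> 2 * \<psi> s"
        using \<psi>[of s] by (intro mult_right_mono) auto
      then have "\<bar>r s * \<psi> s * c' s\<bar> \<le> 2 * \<psi> s"
        using \<psi>[of s] bounds[of s] by (simp add: abs_mult mult_ac)
      then have "\<bar>r s * \<psi> s * c' s\<bar>\<^sup>2 \<le> (2 * \<psi> s)\<^sup>2"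
        by (intro power_mono) auto
      then have "(r s * \<psi> s * c' s)\<^sup>2 * energy e x s \<le> (2 * \<psi> s)\<^sup>2 * energy e x s"
        by (intro mult_right_mono) (auto simp: energy_nonneg)
      then show "(r s * \<psi> s * c' s)\<^sup>2 * energy e x s \<le> 4 * ((\<psi> s)\<^sup>2 * energy e x s)"
        by (simp add: power_mult_distrib)
    qed (use ab in \<open>intro integrable_continuous_interval continuous_intros cont\<Phi> conts cont\<psi>; auto\<close>)+
    finally show ?thesis by simp
  qed
  finally have J_le: "J \<le> (resolvent_const e)\<^sup>2 * (3 * d\<^sup>2 * J + 3 * (4 / (b - a)\<^sup>2 * integral {a..b} (energy e x)) +
      3 * (4 * integral {R..R+1} (\<lambda>s. (\<psi> s)\<^sup>2 * energy e x s)))"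
    by (auto simp: mult_left_mono)
  have "J \<ge> 0"
    unfolding J_def
    by (intro integral_nonneg integrable_continuous_interval continuous_intros cont\<Phi>) (auto simp: energy_nonneg)
  \<comment> \<open>The \<open>\<psi>'\<close> term is thus at most \<open>J / 2\<close>; moving it
    to the left doubles the factor 12 of the other two terms to 24.\<close>
  then have "6 * (resolvent_const e)\<^sup>2 * d\<^sup>2 * J \<le> 1 * J"
    using small by (intro mult_right_mono) auto
  then have J_le': "J \<le> 24 * (resolvent_const e)\<^sup>2 * (integral {a..b} (energy e x) / (b - a)\<^sup>2 + integral {R..R+1} (\<lambda>s. (\<psi> s)\<^sup>2 * energy e x s))"
    using J_le by (simp add: algebra_simps)
  have "integral {b..R} (\<lambda>s. (\<psi> s)\<^sup>2 * energy e x s) = integral {b..R} (\<lambda>s. (\<Phi> s)\<^sup>2 * energy e x s)"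
  proof (rule integral_cong)
    fix s assume "s \<in> {b..R}"
    then have "r s = 1" "c s = 1"
      using ab by (auto simp: r_def c_def intro!: smooth_step_eq_1)
    then show "(\<psi> s)\<^sup>2 * energy e x s = (\<Phi> s)\<^sup>2 * energy e x s"
      by (simp add: \<Phi>_def)
  qed
  also have "\<dots> \<le> J"
    unfolding J_def using ab
    by (intro integral_subset_le integrable_continuous_interval continuous_intros cont\<Phi>)
      (auto simp: energy_nonneg P_def)
  finally show ?thesis
    using J_le' by simp
qed

lemma resolvent_const_pos: "e > 0 \<Longrightarrow> resolvent_const e > 0"
  using C_pos by (simp add: resolvent_const_def)

lemma energy_integrable: "0 \<le> a \<Longrightarrow> energy e x integrable_on {a..b}"
  by (intro integrable_continuous_interval continuous_on_energy) auto

text \<open>The falling cut-off is pushed to infinity, where the tail hypothesis makes the end term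
  arbitrarily small.\<close>

lemma energy_propagation:
  fixes \<psi> \<psi>' :: "real \<Rightarrow> real" and x :: 'a
  assumes e: "e > 0" and deriv: "\<And>s. (\<psi> has_real_derivative \<psi>' s) (at s)"
    and cont: "continuous_on UNIV \<psi>'"
    and \<psi>: "\<And>s. 0 \<le> \<psi> s" "\<And>s. \<psi> s \<le> 1" "\<And>s. \<bar>\<psi>' s\<bar> \<le> d * \<psi> s"
    and small: "6 * (resolvent_const e)\<^sup>2 * d\<^sup>2 \<le> 1"
    and ab: "0 < a" "a < b" "b \<le> R"
    and tail: "((\<lambda>s. (\<psi> s)\<^sup>2 * energy e x s) \<longlongrightarrow> 0) at_top"
  shows "integral {b..R} (\<lambda>s. (\<psi> s)\<^sup>2 * energy e x s) \<le> 24 * (resolvent_const e)\<^sup>2 / (b - a)\<^sup>2 * integral {a..b} (energy e x)"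
proof (rule field_le_epsilon)
  fix \<eta> :: real assume \<eta>: "\<eta> > 0"
  define m where "m = 24 * (resolvent_const e)\<^sup>2"
  have m: "m > 0"
    using resolvent_const_pos[OF e] by (simp add: m_def)
  have "eventually (\<lambda>s. (\<psi> s)\<^sup>2 * energy e x s < \<eta> / m) at_top"
    using tail m \<eta> by (intro order_tendstoD) auto
  then obtain R1 where R1: "\<And>s. s \<ge> R1 \<Longrightarrow> (\<psi> s)\<^sup>2 * energy e x s < \<eta> / m"
    by (auto simp: eventually_at_top_linorder)
  define R2 where "R2 = max R R1"
  have R2: "R \<le> R2" "R1 \<le> R2"
    by (auto simp: R2_def)
  have cont\<psi>: "continuous_on S \<psi>" for S
    using deriv by (intro continuous_at_imp_continuous_on ballI DERIV_isCont)
  have int: "(\<lambda>s. (\<psi> s)\<^sup>2 * energy e x s) integrable_on {c..c'}" if "c \<ge> 0" for c c'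
    using that by (intro integrable_continuous_interval continuous_intros cont\<psi>) auto
  have "integral {R2..R2+1} (\<lambda>s. (\<psi> s)\<^sup>2 * energy e x s) \<le> integral {R2..R2+1} (\<lambda>s. \<eta> / m)"
  proof (rule integral_le)
    show "(\<psi> s)\<^sup>2 * energy e x s \<le> \<eta> / m" if "s \<in> {R2..R2+1}" for s
      using R1[of s] R2 that by simp
  qed (use R2 ab in \<open>auto intro!: int\<close>)
  then have end_le: "integral {R2..R2+1} (\<lambda>s. (\<psi> s)\<^sup>2 * energy e x s) \<le> \<eta> / m"
    by simp
  have "integral {b..R} (\<lambda>s. (\<psi> s)\<^sup>2 * energy e x s) \<le> integral {b..R2} (\<lambda>s. (\<psi> s)\<^sup>2 * energy e x s)"
    using R2 ab by (intro integral_subset_le int) (auto simp: energy_nonneg)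
  also have "\<dots> \<le> m * (integral {a..b} (energy e x) / (b - a)\<^sup>2 + integral {R2..R2+1} (\<lambda>s. (\<psi> s)\<^sup>2 * energy e x s))"
    unfolding m_def using R2 ab
    by (intro energy_propagation_finite[OF e deriv cont \<psi> small]) auto
  also have "\<dots> \<le> m * (integral {a..b} (energy e x) / (b - a)\<^sup>2 + \<eta> / m)"
    using m end_le by (intro mult_left_mono add_left_mono) auto
  also have "\<dots> = 24 * (resolvent_const e)\<^sup>2 / (b - a)\<^sup>2 * integral {a..b} (energy e x) + \<eta>"
    using m by (simp add: ring_distribs flip: m_def)
  finally show "integral {b..R} (\<lambda>s. (\<psi> s)\<^sup>2 * energy e x s) \<le>
    24 * (resolvent_const e)\<^sup>2 / (b - a)\<^sup>2 * integral {a..b} (energy e x) + \<eta>" .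
qed

text \<open>Going from \<open>s\<close> to \<open>t\<close> within unit time costs at most the
  factor \<open>K\<close>, and damping only helps; then average over \<open>s\<close>.\<close>

lemma energy_le_integral:
  assumes K: "K \<ge> 0" "\<And>h y. h \<in> {0..1} \<Longrightarrow> norm (T h y) \<le> K * norm y"
    and t: "t \<ge> 1" and e: "e \<ge> 0"
  shows "energy e x t \<le> K\<^sup>2 * integral {t-1..t} (energy e x)"
proof -
  have "integral {t-1..t} (\<lambda>_. energy e x t) \<le> integral {t-1..t} (\<lambda>s. K\<^sup>2 * energy e x s)"
  proof (rule integral_le)
    fix s assume s: "s \<in> {t-1..t}"
    have "norm (T t x) = norm (T (t - s) (T s x))"
      using T_add[of "t - s" s x] s t by simp
    also have "\<dots> \<le> K * norm (T s x)"
      using s by (intro K) auto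
    finally have "exp (- e * t) * norm (T t x) \<le> exp (- e * s) * (K * norm (T s x))"
      using s e K by (intro mult_mono) (auto intro!: mult_left_mono)
    then have "(exp (- e * t) * norm (T t x))\<^sup>2 \<le> (exp (- e * s) * (K * norm (T s x)))\<^sup>2"
      by (intro power_mono) auto
    then show "energy e x t \<le> K\<^sup>2 * energy e x s"
      by (simp add: energy_def power_mult_distrib mult_ac)
  qed (use t in \<open>auto intro!: integrable_on_mult_right energy_integrable\<close>)
  then show ?thesis by simp
qed

lemma energy_le:
  assumes "norm (T s x) \<le> K * norm x" "s \<ge> 0" "e \<ge> 0"
  shows "energy e x s \<le> (K * norm x)\<^sup>2"
proof -
  have "exp (- e * s) * norm (T s x) \<le> 1 * (K * norm x)"
    using assms by (intro mult_mono) auto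
  then show ?thesis
    unfolding energy_def by (intro power_mono) auto
qed

section \<open>Lowering the exponential growth rate\<close>

definition exp_bounded :: "real \<Rightarrow> bool" where
  "exp_bounded w \<longleftrightarrow> (\<exists>K. \<forall>t\<ge>0. \<forall>x. norm (T t x) \<le> K * exp (w * t) * norm x)"

lemma exp_bounded_mono:
  assumes "exp_bounded w" "w \<le> v"
  shows "exp_bounded v"
proof -
  obtain K where K: "\<And>t x. t \<ge> 0 \<Longrightarrow> norm (T t x) \<le> K * exp (w * t) * norm x"
    using assms(1) unfolding exp_bounded_def by blast
  have "norm (T t x) \<le> \<bar>K\<bar> * exp (v * t) * norm x" if "t \<ge> 0" for t x
  proof -
    have "K * exp (w * t) * norm x \<le> \<bar>K\<bar> * exp (v * t) * norm x"
      using that assms(2) by (intro mult_right_mono mult_mono) (auto intro!: mult_right_mono)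
    then show ?thesis
      using K[OF that, of x] by linarith
  qed
  then show ?thesis
    unfolding exp_bounded_def by blast
qed

lemma energy_tendsto_0:
  assumes "exp_bounded w" "w < v" and le: "\<And>s. \<bar>\<psi> s\<bar> * exp (- e * s) \<le> B * exp (- v * s)"
  shows "((\<lambda>s. (\<psi> s)\<^sup>2 * energy e x s) \<longlongrightarrow> 0) at_top"
proof -
  obtain K where K: "\<And>t x. t \<ge> 0 \<Longrightarrow> norm (T t x) \<le> K * exp (w * t) * norm x"
    using assms(1) unfolding exp_bounded_def by blast
  have "0 \<le> B"
    using le[of 0] abs_ge_zero[of "\<psi> 0"] by simp
  have bound: "\<bar>\<psi> s\<bar> * exp (- e * s) * norm (T s x) \<le> B * K * norm x * exp ((w - v) * s)" if "s \<ge> 0" for s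
  proof -
    have "\<bar>\<psi> s\<bar> * exp (- e * s) * norm (T s x) \<le> (B * exp (- v * s)) * (K * exp (w * s) * norm x)"
      using \<open>0 \<le> B\<close> by (intro mult_mono[OF le K[OF that]]) auto
    also have "\<dots> = B * K * norm x * (exp (- v * s) * exp (w * s))"
      by (simp only: mult_ac)
    also have "exp (- v * s) * exp (w * s) = exp ((w - v) * s)"
      by (simp add: algebra_simps flip: exp_add)
    finally show ?thesis .
  qed
  have "((\<lambda>s. B * K * norm x * exp ((w - v) * s)) \<longlongrightarrow> B * K * norm x * 0) at_top"
  proof (rule tendsto_mult_left)
    have "filterlim (\<lambda>s. (w - v) * s) at_bot at_top"
      by (rule filterlim_tendsto_neg_mult_at_bot[OF tendsto_const _ filterlim_ident]) (use assms(2) in simp)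
    then show "((\<lambda>s. exp ((w - v) * s)) \<longlongrightarrow> 0) at_top"
      by (rule filterlim_compose[OF exp_at_bot])
  qed
  then have upper: "((\<lambda>s. B * K * norm x * exp ((w - v) * s)) \<longlongrightarrow> 0) at_top"
    by simp
  have "((\<lambda>s. \<bar>\<psi> s\<bar> * exp (- e * s) * norm (T s x)) \<longlongrightarrow> 0) at_top"
  proof (rule tendsto_sandwich[OF _ _ tendsto_const upper])
    show "eventually (\<lambda>s. \<bar>\<psi> s\<bar> * exp (- e * s) * norm (T s x) \<le> B * K * norm x * exp ((w - v) * s)) at_top"
      using bound by (rule eventually_at_top_linorderI)
  qed (auto intro!: always_eventually)
  then have "((\<lambda>s. (\<bar>\<psi> s\<bar> * exp (- e * s) * norm (T s x))\<^sup>2) \<longlongrightarrow> 0\<^sup>2) at_top"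
    by (rule tendsto_power)
  then show ?thesis
    by (simp add: energy_def power_mult_distrib mult_ac)
qed

text \<open>
  Multiplying by the logistic cut-off \<open>1 / (1 + exp (\<delta> (s - N)))\<close> costs only a factor \<open>\<delta>\<close> in the
  energy inequality, but makes orbits of growth \<open>w\<close> integrable as soon as \<open>w < e + \<delta>\<close>.
\<close>

lemma exp_bounded_step:
  assumes bdd: "exp_bounded w" and e: "e > 0" and d: "w < e + d" and small: "6 * (resolvent_const e)\<^sup>2 * d\<^sup>2 \<le> 1"
  shows "exp_bounded e"
proof (cases "d > 0")
  case False
  then show ?thesis
    using exp_bounded_mono[OF bdd] d by auto
next
  case True
  obtain K where K: "K \<ge> 1" "\<And>t x. t \<in> {0..3} \<Longrightarrow> norm (T t x) \<le> K * norm x"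
    using bound_on_interval[of 3] by blast
  \<comment> \<open>The summands serve \<open>t > 3\<close> and \<open>t \<le> 3\<close>. Here 96 is
    4 times 24, the 4 coming from \<open>\<psi> \<ge> 1 / 2\<close>; one \<open>K\<^sup>2\<close>
    bounds the start window \<open>{1..2}\<close>, the other the passage to time
    \<open>t\<close>.\<close>
  define B where "B = K\<^sup>2 * (96 * (resolvent_const e)\<^sup>2 * K\<^sup>2) + K\<^sup>2"
  have B: "K\<^sup>2 * (96 * (resolvent_const e)\<^sup>2 * K\<^sup>2) \<le> B" "K\<^sup>2 \<le> B" "0 \<le> B"
    by (auto simp: B_def)
  have bound: "energy e x t \<le> B * (norm x)\<^sup>2" if t: "t \<ge> 0" for t x
  proof (cases "t \<le> 3")
    case True
    then have "energy e x t \<le> (K * norm x)\<^sup>2"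
      using t e by (intro energy_le K) auto
    also have "\<dots> \<le> B * (norm x)\<^sup>2"
      unfolding power_mult_distrib using B by (intro mult_right_mono) auto
    finally show ?thesis .
  next
    case False
    \<comment> \<open>Centred at the target time, so that \<open>\<psi>\<close> is at least 1/2 up
      to \<open>t\<close> and the constants do not depend on \<open>t\<close>.\<close>
    define \<psi> where "\<psi> s = 1 / (1 + exp (d * (s - t)))" for s
    define \<psi>' where "\<psi>' s = - d * exp (d * (s - t)) / (1 + exp (d * (s - t)))\<^sup>2" for s
    have pos: "1 + exp y > 0" for y :: real
      by (simp add: add_pos_pos)
    have nz: "1 + exp y \<noteq> 0" for y :: real
      using pos[of y] by simp
    have deriv: "(\<psi> has_real_derivative \<psi>' s) (at s)" for s
      unfolding \<psi>_def[abs_def] \<psi>'_def using nz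
      by (auto intro!: derivative_eq_intros simp: power2_eq_square)
    have cont\<psi>': "continuous_on UNIV \<psi>'"
      unfolding \<psi>'_def[abs_def] using nz by (intro continuous_intros) auto
    have cont\<psi>: "continuous_on S \<psi>" for S
      unfolding \<psi>_def[abs_def] using nz by (intro continuous_intros) auto
    have \<psi>: "0 \<le> \<psi> s" "\<psi> s \<le> 1" for s
      using pos[of "d * (s - t)"] by (auto simp: \<psi>_def)
    have \<psi>'_le: "\<bar>\<psi>' s\<bar> \<le> d * \<psi> s" for s
    proof -
      have "\<bar>\<psi>' s\<bar> = d * \<psi> s * (exp (d * (s - t)) / (1 + exp (d * (s - t))))"
        using True pos[of "d * (s - t)"] by (simp add: \<psi>'_def \<psi>_def abs_mult power2_eq_square)
      also have "\<dots> \<le> d * \<psi> s * 1"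
        using True \<psi> pos[of "d * (s - t)"] by (intro mult_left_mono) auto
      finally show ?thesis by simp
    qed
    have "\<bar>\<psi> s\<bar> * exp (- e * s) \<le> exp (d * t) * exp (- (e + d) * s)" for s
    proof -
      have "\<psi> s \<le> exp (- (d * (s - t)))"
        using pos[of "d * (s - t)"] by (simp add: \<psi>_def exp_minus divide_simps)
      then have "\<psi> s * exp (- e * s) \<le> exp (- (d * (s - t))) * exp (- e * s)"
        by (intro mult_right_mono) auto
      also have "\<dots> = exp (d * t) * exp (- (e + d) * s)"
        by (simp add: algebra_simps flip: exp_add)
      finally show ?thesis
        using \<psi> by simp
    qed
    then have tail: "((\<lambda>s. (\<psi> s)\<^sup>2 * energy e x s) \<longlongrightarrow> 0) at_top"
      by (rule energy_tendsto_0[OF bdd d])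
    have int: "(\<lambda>s. (\<psi> s)\<^sup>2 * energy e x s) integrable_on {c..c'}" if "c \<ge> 0" for c c'
      using that by (intro integrable_continuous_interval continuous_intros cont\<psi>) auto
    have "integral {1..2} (energy e x) \<le> integral {1..2::real} (\<lambda>_. (K * norm x)\<^sup>2)"
      using e by (intro integral_le energy_integrable energy_le K) auto
    then have start: "integral {1..2} (energy e x) \<le> (K * norm x)\<^sup>2"
      by simp
    have "integral {t-1..t} (energy e x) \<le> integral {2..t} (energy e x)"
      using False by (intro integral_subset_le energy_integrable) (auto simp: energy_nonneg)
    also have "\<dots> \<le> integral {2..t} (\<lambda>s. 4 * ((\<psi> s)\<^sup>2 * energy e x s))"
    proof (intro integral_le energy_integrable integrable_on_mult_right int)
      fix s assume "s \<in> {2..t}"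
      then have "exp (d * (s - t)) \<le> 1"
        using True by (simp add: mult_nonneg_nonpos)
      then have "1 \<le> 2 * \<psi> s"
        using pos[of "d * (s - t)"] by (simp add: \<psi>_def)
      then have "1\<^sup>2 \<le> (2 * \<psi> s)\<^sup>2"
        by (intro power_mono) auto
      then have "1 * energy e x s \<le> (2 * \<psi> s)\<^sup>2 * energy e x s"
        by (intro mult_right_mono) (auto simp: energy_nonneg)
      then show "energy e x s \<le> 4 * ((\<psi> s)\<^sup>2 * energy e x s)"
        by (simp add: power_mult_distrib)
    qed auto
    also have "\<dots> = 4 * integral {2..t} (\<lambda>s. (\<psi> s)\<^sup>2 * energy e x s)"
      by simp
    also have "\<dots> \<le> 4 * (24 * (resolvent_const e)\<^sup>2 / (2 - 1)\<^sup>2 * integral {1..2} (energy e x))"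
      using False
      by (intro mult_left_mono energy_propagation[OF e deriv cont\<psi>' \<psi> \<psi>'_le small _ _ _ tail]) auto
    also have "\<dots> \<le> 4 * (24 * (resolvent_const e)\<^sup>2 / (2 - 1)\<^sup>2 * (K * norm x)\<^sup>2)"
      using start by (intro mult_left_mono) auto
    finally have "K\<^sup>2 * integral {t-1..t} (energy e x) \<le> K\<^sup>2 * (4 * (24 * (resolvent_const e)\<^sup>2 / (2 - 1)\<^sup>2 * (K * norm x)\<^sup>2))"
      by (intro mult_left_mono) auto
    moreover have "energy e x t \<le> K\<^sup>2 * integral {t-1..t} (energy e x)"
      using K e False by (intro energy_le_integral) auto
    ultimately have "energy e x t \<le> K\<^sup>2 * (96 * (resolvent_const e)\<^sup>2 * K\<^sup>2) * (norm x)\<^sup>2"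
      by (simp add: power_mult_distrib mult_ac)
    also have "\<dots> \<le> B * (norm x)\<^sup>2"
      using B by (intro mult_right_mono) auto
    finally show ?thesis .
  qed
  have "norm (T t x) \<le> sqrt B * exp (e * t) * norm x" if t: "t \<ge> 0" for t x
  proof -
    have "exp (- e * t) * norm (T t x) \<le> sqrt (B * (norm x)\<^sup>2)"
      using bound[OF t, of x] unfolding energy_def by (rule real_le_rsqrt)
    then have "exp (e * t) * (exp (- e * t) * norm (T t x)) \<le> exp (e * t) * (sqrt B * norm x)"
      by (intro mult_left_mono) (auto simp: real_sqrt_mult)
    then show ?thesis
      by (simp add: mult_ac exp_minus)
  qed
  then show ?thesis
    unfolding exp_bounded_def by blast
qed

end

subsection \<open>Growth of the semigroup\<close>

context Kreiss_semigroup
begin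

text \<open>Starting from any growth rate, \<open>exp_bounded_step\<close> lowers it repeatedly by
  \<open>d / 2\<close> until it reaches \<open>e\<close>. One \<open>d\<close> works throughout
  because \<open>resolvent_const\<close> does not increase with its argument.\<close>

lemma exp_bounded_pos:
  assumes e: "e > 0" and \<alpha>: "\<alpha> \<ge> 0"
  shows "exp_bounded e"
proof -
  \<comment> \<open>Makes the quantity in \<open>small\<close> at most 6/9.\<close>
  define d where "d = 1 / (3 * resolvent_const e)"
  have d: "d > 0"
    using resolvent_const_pos[OF e] by (simp add: d_def)
  have small: "6 * (resolvent_const v)\<^sup>2 * d\<^sup>2 \<le> 1" if "v \<ge> e" for v
  proof -
    have "resolvent_const v \<le> resolvent_const e"
      unfolding resolvent_const_def using that e C_pos \<alpha> by (intro divide_left_mono powr_mono2) auto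
    then have "resolvent_const v * d \<le> resolvent_const e * d"
      using d by (intro mult_right_mono) auto
    also have "resolvent_const e * d = 1 / 3"
      using resolvent_const_pos[OF e] by (simp add: d_def)
    finally have "(resolvent_const v * d)\<^sup>2 \<le> (1 / 3)\<^sup>2"
      using resolvent_const_pos[of v] e that d by (intro power_mono) auto
    then show ?thesis
      by (simp add: power_mult_distrib power_divide)
  qed
  obtain K w where w: "w \<ge> 0" "\<And>t x. t \<ge> 0 \<Longrightarrow> norm (T t x) \<le> K * exp (w * t) * norm x"
    using exponential_growth by blast
  have "exp_bounded (max e (w - real n * (d / 2)))" for n
  proof (induction n)
    case 0
    have "exp_bounded w"
      using w unfolding exp_bounded_def by blast
    then show ?case
      by (rule exp_bounded_mono) simp
  next
    case (Suc n)
    show ?case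
    proof (rule exp_bounded_step[OF Suc])
      show "max e (w - real n * (d / 2)) < max e (w - real (Suc n) * (d / 2)) + d"
        using d by (auto simp: max_def field_simps)
      show "max e (w - real (Suc n) * (d / 2)) > 0"
        using e by auto
    qed (use small in auto)
  qed
  moreover obtain n :: nat where "w / (d / 2) \<le> real n"
    using real_arch_simple by blast
  then have "max e (w - real n * (d / 2)) = e"
    using d e by (simp add: field_simps)
  ultimately show ?thesis
    by metis
qed

text \<open>The constant weight 1 is now allowed: growth at rate \<open>e / 2\<close> makes the
  energy damped at rate \<open>e\<close> vanish at infinity.\<close>

lemma energy_propagation_const:
  assumes e: "e > 0" and \<alpha>: "\<alpha> \<ge> 0" and ab: "0 < a" "a < b" "b \<le> R"
  shows "integral {b..R} (energy e x) \<le> 24 * (resolvent_const e)\<^sup>2 / (b - a)\<^sup>2 * integral {a..b} (energy e x)"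
proof -
  have "((\<lambda>s. 1\<^sup>2 * energy e x s) \<longlongrightarrow> 0) at_top"
    by (rule energy_tendsto_0[of "e/2" e _ _ 1]) (use exp_bounded_pos e \<alpha> in auto)
  then show ?thesis
    using energy_propagation[OF e, of "\<lambda>_. 1" "\<lambda>_. 0" 0 a b R x] ab by auto
qed

lemma energy_0: "energy 0 x s = (norm (T s x))\<^sup>2"
  by (simp add: energy_def)

lemma energy_eq_energy_0: "energy e x s = exp (- (2 * e * s)) * energy 0 x s"
  by (simp add: energy_def power_mult_distrib flip: exp_double)

text \<open>With \<open>e = 1 / t\<close> the damping costs at most the factor \<open>exp 2\<close>
  on \<open>{2..t}\<close>, while \<open>resolvent_const e\<close> becomes
  \<open>C * t powr \<alpha>\<close>.\<close>

lemma orbit_square_integral_le: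
  assumes \<alpha>: "\<alpha> \<ge> 0"
  shows "\<exists>B>0. \<forall>t\<ge>2. \<forall>x. integral {2..t} (energy 0 x) \<le> B * (t powr \<alpha>)\<^sup>2 * (norm x)\<^sup>2"
proof -
  obtain K where K: "K \<ge> 1" "\<And>t x. t \<in> {0..2} \<Longrightarrow> norm (T t x) \<le> K * norm x"
    using bound_on_interval[of 2] by blast
  have "integral {2..t} (energy 0 x) \<le> (24 * exp 2 * C\<^sup>2 * K\<^sup>2) * (t powr \<alpha>)\<^sup>2 * (norm x)\<^sup>2" if t: "t \<ge> 2" for t x
  proof -
    define e where "e = 1 / t"
    have e: "e > 0"
      using t by (simp add: e_def)
    have M_e: "resolvent_const e = C * t powr \<alpha>"
      using t by (simp add: resolvent_const_def e_def powr_divide)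
    have "integral {1..2} (energy e x) \<le> integral {1..2::real} (\<lambda>_. (K * norm x)\<^sup>2)"
    proof (rule integral_le)
      show "energy e x s \<le> (K * norm x)\<^sup>2" if "s \<in> {1..2}" for s
        using that e K(2)[of s x] by (intro energy_le) auto
    qed (auto intro!: energy_integrable)
    then have start: "integral {1..2} (energy e x) \<le> (K * norm x)\<^sup>2"
      by simp
    have "integral {2..t} (energy 0 x) \<le> integral {2..t} (\<lambda>s. exp 2 * energy e x s)"
    proof (rule integral_le)
      fix s assume s: "s \<in> {2..t}"
      have "1 * energy 0 x s \<le> (exp 2 * exp (- (2 * e * s))) * energy 0 x s"
        using s t by (intro mult_right_mono energy_nonneg) (simp add: e_def field_simps flip: exp_add)
      then show "energy 0 x s \<le> exp 2 * energy e x s"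
        by (simp add: energy_eq_energy_0[of e])
    qed (auto intro!: energy_integrable integrable_on_mult_right)
    also have "\<dots> = exp 2 * integral {2..t} (energy e x)"
      by simp
    also have "\<dots> \<le> exp 2 * (24 * (resolvent_const e)\<^sup>2 / (2 - 1)\<^sup>2 * integral {1..2} (energy e x))"
      using t by (intro mult_left_mono energy_propagation_const e \<alpha>) auto
    also have "\<dots> \<le> exp 2 * (24 * (resolvent_const e)\<^sup>2 / (2 - 1)\<^sup>2 * (K * norm x)\<^sup>2)"
      using start by (intro mult_left_mono) auto
    also have "\<dots> = (24 * exp 2 * C\<^sup>2 * K\<^sup>2) * (t powr \<alpha>)\<^sup>2 * (norm x)\<^sup>2"
      by (simp add: M_e power_mult_distrib)
    finally show ?thesis .
  qed
  moreover have "24 * exp 2 * C\<^sup>2 * K\<^sup>2 > 0"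
    using C_pos K by simp
  ultimately show ?thesis by blast
qed

text \<open>
  Propagating the energy at the rate \<open>e = 1 / L\<close> from the window \<open>[t - 2 L, t - L]\<close> to \<open>t\<close> gives a
  lower bound for the mean square over that window which, for \<open>\<alpha> \<le> 1\<close>, is uniform in \<open>L\<close>.
\<close>

lemma orbit_window_bound:
  assumes \<alpha>: "0 \<le> \<alpha>" "\<alpha> \<le> 1"
  shows "\<exists>B>0. \<forall>t L x. 1 \<le> L \<longrightarrow> 2 * L < t \<longrightarrow>
     energy 0 x t \<le> B * integral {t - 2 * L..t - L} (energy 0 x)"
proof -
  obtain K where K: "K \<ge> 1" "\<And>t x. t \<in> {0..1} \<Longrightarrow> norm (T t x) \<le> K * norm x"
    using bound_on_interval[of 1] by blast
  have "energy 0 x t \<le> (24 * exp 4 * C\<^sup>2 * K\<^sup>2) * integral {t - 2 * L..t - L} (energy 0 x)"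
    if L: "1 \<le> L" "2 * L < t" for t L x
  proof -
    define e where "e = 1 / L"
    have e: "e > 0"
      using L by (simp add: e_def)
    have "resolvent_const e = C * L powr \<alpha>"
      using L by (simp add: resolvent_const_def e_def powr_divide)
    \<comment> \<open>Here \<open>\<alpha> \<le> 1\<close> enters: the squared window length offsets
      the resolvent constant, uniformly in \<open>L\<close>.\<close>
    moreover have "L powr \<alpha> \<le> L"
      using powr_mono[of \<alpha> 1 L] L \<alpha> by simp
    ultimately have "resolvent_const e \<le> C * L"
      using C_pos by simp
    then have "(resolvent_const e)\<^sup>2 \<le> (C * L)\<^sup>2"
      using resolvent_const_pos[OF e] by (intro power_mono) auto
    then have M_e: "(resolvent_const e)\<^sup>2 / L\<^sup>2 \<le> C\<^sup>2"
      using L by (simp add: power_mult_distrib divide_le_eq)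
    have I_nonneg: "0 \<le> integral {t - 2 * L..t - L} (energy e x)"
      using L by (intro integral_nonneg energy_integrable) (auto simp: energy_nonneg)
    have "energy e x t \<le> K\<^sup>2 * integral {t-1..t} (energy e x)"
      using L e K by (intro energy_le_integral) auto
    also have "\<dots> \<le> K\<^sup>2 * integral {t-L..t} (energy e x)"
      using L by (intro mult_left_mono integral_subset_le energy_integrable) (auto simp: energy_nonneg)
    also have "\<dots> \<le> K\<^sup>2 * (24 * (resolvent_const e)\<^sup>2 / ((t - L) - (t - 2 * L))\<^sup>2 * integral {t - 2 * L..t - L} (energy e x))"
      using L by (intro mult_left_mono energy_propagation_const e \<alpha>) auto
    also have "\<dots> = 24 * K\<^sup>2 * integral {t - 2 * L..t - L} (energy e x) * ((resolvent_const e)\<^sup>2 / L\<^sup>2)"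
      by simp
    also have "\<dots> \<le> 24 * K\<^sup>2 * integral {t - 2 * L..t - L} (energy e x) * C\<^sup>2"
      using I_nonneg by (intro mult_left_mono M_e) auto
    \<comment> \<open>On the window \<open>e * s\<close> is at least \<open>e * t - 2\<close>. The
      damping \<open>exp (- 2 * e * t)\<close> cancels against that of \<open>energy e x t\<close>,
      leaving \<open>exp 4\<close>.\<close>
    also have "integral {t - 2 * L..t - L} (energy e x) \<le>
        integral {t - 2 * L..t - L} (\<lambda>s. exp (4 - 2 * e * t) * energy 0 x s)"
    proof (rule integral_le)
      fix s assume s: "s \<in> {t - 2 * L..t - L}"
      have "e * (t - 2 * L) \<le> e * s"
        using s e by (intro mult_left_mono) auto
      moreover have "e * (t - 2 * L) = e * t - 2"
        using L by (simp add: e_def field_simps)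
      ultimately have "- (2 * e * s) \<le> 4 - 2 * e * t"
        by simp
      then show "energy e x s \<le> exp (4 - 2 * e * t) * energy 0 x s"
        unfolding energy_eq_energy_0[of e] by (intro mult_right_mono energy_nonneg) simp
    qed (use L in \<open>auto intro!: energy_integrable integrable_on_mult_right\<close>)
    also have "\<dots> = exp (4 - 2 * e * t) * integral {t - 2 * L..t - L} (energy 0 x)"
      by simp
    finally have "energy e x t \<le> 24 * K\<^sup>2 * (exp (4 - 2 * e * t) * integral {t - 2 * L..t - L} (energy 0 x)) * C\<^sup>2"
      by (simp add: mult_left_mono mult_right_mono)
    then have "exp (2 * e * t) * energy e x t \<le>
        exp (2 * e * t) * (24 * K\<^sup>2 * (exp (4 - 2 * e * t) * integral {t - 2 * L..t - L} (energy 0 x)) * C\<^sup>2)"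
      by (intro mult_left_mono) auto
    also have "\<dots> = (exp (2 * e * t) * exp (4 - 2 * e * t)) * (24 * K\<^sup>2 * integral {t - 2 * L..t - L} (energy 0 x) * C\<^sup>2)"
      by (simp only: mult_ac)
    finally show ?thesis
      by (simp add: energy_eq_energy_0[of e] exp_minus mult_ac flip: exp_add)
  qed
  moreover have "24 * exp 4 * C\<^sup>2 * K\<^sup>2 > 0"
    using C_pos K by simp
  ultimately show ?thesis by blast
qed

text \<open>Summing over the dyadic windows \<open>L = 2 ^ k\<close> produces the logarithm.\<close>

lemma orbit_dyadic_bound:
  assumes \<alpha>: "0 \<le> \<alpha>" "\<alpha> \<le> 1"
  shows "\<exists>B>0. \<forall>t x n. 2 ^ n \<le> t - 2 \<longrightarrow>
     real n * (norm (T t x))\<^sup>2 \<le> B * (t powr \<alpha>)\<^sup>2 * (norm x)\<^sup>2"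
proof -
  obtain B1 where B1: "B1 > 0"
    "\<And>t x. t \<ge> 2 \<Longrightarrow> integral {2..t} (energy 0 x) \<le> B1 * (t powr \<alpha>)\<^sup>2 * (norm x)\<^sup>2"
    using orbit_square_integral_le \<alpha> by blast
  obtain B2 where B2: "B2 > 0" "\<And>t L x. 1 \<le> L \<Longrightarrow> 2 * L < t \<Longrightarrow>
     energy 0 x t \<le> B2 * integral {t - 2 * L..t - L} (energy 0 x)"
    using orbit_window_bound \<alpha> by blast
  \<comment> \<open>The windows for \<open>L = 2 ^ k\<close>, \<open>k < n\<close>, tile
    \<open>{t - 2 ^ n..t - 1}\<close>, which stays inside \<open>{2..t}\<close>.\<close>
  have windows: "real n * energy 0 x t \<le> B2 * integral {t - 2 ^ n..t - 1} (energy 0 x)"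
    if "2 ^ n \<le> t - 2" for n t x
    using that
  proof (induction n)
    case (Suc n)
    have one_le: "(1::real) \<le> 2 ^ n"
      by simp
    then have le: "2 ^ n \<le> t - 2"
      using Suc.prems unfolding power_Suc by linarith
    have "energy 0 x t \<le> B2 * integral {t - 2 * 2 ^ n..t - 2 ^ n} (energy 0 x)"
      using Suc.prems by (intro B2) auto
    moreover have "real n * energy 0 x t \<le> B2 * integral {t - 2 ^ n..t - 1} (energy 0 x)"
      by (rule Suc.IH[OF le])
    ultimately have "real (Suc n) * energy 0 x t \<le> B2 *
        (integral {t - 2 * 2 ^ n..t - 2 ^ n} (energy 0 x) + integral {t - 2 ^ n..t - 1} (energy 0 x))"
      by (simp add: algebra_simps)
    also have "integral {t - 2 * 2 ^ n..t - 2 ^ n} (energy 0 x) + integral {t - 2 ^ n..t - 1} (energy 0 x)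
        = integral {t - 2 * 2 ^ n..t - 1} (energy 0 x)"
      using Suc.prems one_le by (intro Henstock_Kurzweil_Integration.integral_combine energy_integrable) auto
    finally show ?case
      by simp
  qed simp
  have "real n * (norm (T t x))\<^sup>2 \<le> (B2 * B1) * (t powr \<alpha>)\<^sup>2 * (norm x)\<^sup>2" if n: "2 ^ n \<le> t - 2" for n t x
  proof -
    have "(1::real) \<le> 2 ^ n"
      by simp
    then have t: "t \<ge> 3"
      using n by linarith
    have "real n * (norm (T t x))\<^sup>2 \<le> B2 * integral {t - 2 ^ n..t - 1} (energy 0 x)"
      using windows[OF n, of x] by (simp add: energy_0)
    also have "\<dots> \<le> B2 * integral {2..t} (energy 0 x)"
      using B2(1) n t by (intro mult_left_mono integral_subset_le energy_integrable) (auto simp: energy_nonneg)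
    also have "\<dots> \<le> B2 * (B1 * (t powr \<alpha>)\<^sup>2 * (norm x)\<^sup>2)"
      using B1(2)[of t x] B2(1) t by (intro mult_left_mono) auto
    finally show ?thesis
      by (simp only: mult_ac)
  qed
  then show ?thesis
    using B1(1) B2(1) by (intro exI[of _ "B2 * B1"]) auto
qed

text \<open>Take the largest \<open>n\<close> with \<open>2 ^ n \<le> t - 2\<close>; it is at least
  \<open>ln t / 2\<close>, and dividing by it gives the logarithm.\<close>

lemma norm_T_le:
  assumes \<alpha>: "0 \<le> \<alpha>" "\<alpha> \<le> 1"
  shows "\<exists>B>0. \<forall>t\<ge>8. \<forall>x. norm (T t x) \<le> B * (t powr \<alpha> / sqrt (ln t)) * norm x"
proof -
  obtain B where B: "B > 0" "\<And>t x n. 2 ^ n \<le> t - 2 \<Longrightarrow>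
     real n * (norm (T t x))\<^sup>2 \<le> B * (t powr \<alpha>)\<^sup>2 * (norm x)\<^sup>2"
    using orbit_dyadic_bound[OF \<alpha>] by blast
  have "norm (T t x) \<le> sqrt (2 * B) * (t powr \<alpha> / sqrt (ln t)) * norm x" if t: "t \<ge> 8" for t x
  proof -
    define n where "n = nat \<lfloor>log 2 (t - 2)\<rfloor>"
    have log_nonneg: "0 \<le> log 2 (t - 2)"
      using t by simp
    then have n: "real n \<le> log 2 (t - 2)" "log 2 (t - 2) \<le> real n + 1"
      unfolding n_def by auto
    have "2 ^ n = 2 powr real n"
      by (simp add: powr_realpow)
    also have "\<dots> \<le> t - 2"
      using n(1) t by (simp add: le_log_iff)
    finally have "real n * (norm (T t x))\<^sup>2 \<le> B * (t powr \<alpha>)\<^sup>2 * (norm x)\<^sup>2"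
      by (rule B)
    moreover have "ln t / 2 \<le> real n"
    proof -
      \<comment> \<open>The threshold 8 gives \<open>t \<le> ((t - 2) / 2)\<^sup>2\<close>. The
        inner division by 2 absorbs the 1 lost by rounding down, the square gives the 1/2 in front
        of \<open>ln t\<close>.\<close>
      have "8 * t \<le> t * t"
        using t by (intro mult_right_mono) auto
      then have "t \<le> ((t - 2) / 2)\<^sup>2"
        by (simp add: power2_eq_square field_simps)
      then have "ln t \<le> ln (((t - 2) / 2)\<^sup>2)"
        using t by (subst ln_le_cancel_iff) auto
      also have "\<dots> = 2 * ln ((t - 2) / 2)"
        using t by (simp add: ln_realpow)
      finally have 1: "ln t / 2 \<le> ln ((t - 2) / 2)"
        by simp
      have "ln ((t - 2) / 2) * ln 2 \<le> ln ((t - 2) / 2) * 1"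
        using t ln_2_less_1 by (intro mult_left_mono) auto
      then have "ln ((t - 2) / 2) \<le> ln ((t - 2) / 2) / ln 2"
        by (simp add: le_divide_eq)
      also have "\<dots> = log 2 ((t - 2) / 2)"
        by (simp add: log_def)
      also have "\<dots> = log 2 (t - 2) - 1"
        using t by (simp add: log_divide)
      finally show ?thesis
        using 1 n(2) by linarith
    qed
    then have "ln t / 2 * (norm (T t x))\<^sup>2 \<le> real n * (norm (T t x))\<^sup>2"
      by (intro mult_right_mono) auto
    ultimately have "ln t / 2 * (norm (T t x))\<^sup>2 \<le> B * (t powr \<alpha>)\<^sup>2 * (norm x)\<^sup>2"
      by linarith
    moreover have ln_pos: "ln t > 0"
      using t by simp
    ultimately have "(norm (T t x))\<^sup>2 \<le> 2 * B * (t powr \<alpha>)\<^sup>2 * (norm x)\<^sup>2 / ln t"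
      by (simp add: field_simps)
    also have "\<dots> = (sqrt (2 * B) * (t powr \<alpha> / sqrt (ln t)) * norm x)\<^sup>2"
      using ln_pos B(1) by (simp add: power_mult_distrib power_divide)
    finally show ?thesis
      by (rule power2_le_imp_le) (use B(1) ln_pos in simp)
  qed
  then show ?thesis
    using B(1) by (intro exI[of _ "sqrt (2 * B)"]) auto
qed

end

theorem theorem1:
  fixes T :: "real \<Rightarrow> 'a::complex_hilbert_space \<Rightarrow> 'a"
    and A :: "'a \<Rightarrow> 'a" and D :: "'a set" and \<alpha> :: real
  assumes "0 < \<alpha>" and "\<alpha> \<le> 1"
    and "C0_semigroup T"
    and "is_generator T D (\<lambda>x. - A x)"
    and "Kreiss_bounded \<alpha> T"
  shows "(\<lambda>t. onorm (T t)) \<in> O[at_top](\<lambda>t. t powr \<alpha> / sqrt (ln t))"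
proof -
  \<comment> \<open>The locale is instantiated with the generator for which
    \<open>Kreiss_bounded\<close> states its resolvent bound.\<close>
  obtain D' A' C where DAC: "is_generator T D' (\<lambda>x. - A' x)" "C > 0"
    "\<And>l v. Re l < 0 \<Longrightarrow> v \<in> D' \<Longrightarrow> norm v \<le> C / (- Re l) powr \<alpha> * norm (l *\<^sub>C v - A' v)"
    using Kreiss_bounded_resolvent[OF assms(5)] by metis
  interpret Kreiss_semigroup T D' A' C \<alpha>
    by unfold_locales (use assms(3) DAC in auto)
  obtain B where B: "B > 0" "\<And>t x. t \<ge> 8 \<Longrightarrow> norm (T t x) \<le> B * (t powr \<alpha> / sqrt (ln t)) * norm x"
    using norm_T_le assms(1,2) by (metis less_imp_le)
  show ?thesis
  proof (rule bigoI)
    show "eventually (\<lambda>t. norm (onorm (T t)) \<le> B * norm (t powr \<alpha> / sqrt (ln t))) at_top"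
    proof (rule eventually_at_top_linorderI)
      fix t :: real assume t: "t \<ge> 8"
      have "onorm (T t) \<le> B * (t powr \<alpha> / sqrt (ln t))"
        using t B(1) by (intro onorm_bound B(2)) auto
      moreover have "0 \<le> onorm (T t)"
        using t by (intro onorm_pos_le bounded_linear_T) auto
      ultimately show "norm (onorm (T t)) \<le> B * norm (t powr \<alpha> / sqrt (ln t))"
        using t by simp
    qed
  qed
qed

end
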